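(* Let $X$ be a complex Hilbert space and let $A$ be the generator of a bounded $C_0$-semigroup $(T(t))_{t\ge0}$ on $X$. Suppose that $\sigma(A)\cap i\mathbb{R}=\emptyset$ and that $M\colon\mathbb{R}_+\to(0,\infty)$ is a continuous non-decreasing function of positive increase such that $\|R(is,A)\|\le M(|s|)$ for all $s\in\mathbb{R}$. Then $$\|T(t)A^{-1}\|=O\left(\frac{1}{M^{-1}(t)}\right),\quad t\to\infty.$$
   Context: $\mathbb{R}_+=[0,\infty)$. A $C_0$-semigroup is bounded if $\sup_{t\ge0}\|T(t)\|<\infty$. For a closed operator $A$, $\sigma(A)$ is its spectrum and $R(z,A)=(zI-A)^{-1}$ for $z\notin\sigma(A)$. Given $a\ge0$, a measurable function $M\colon[a,\infty)\to(0,\infty)$ has positive increase if there exist constants $\alpha>0$, $c\in(0,1]$ and $s_0\ge a$ with $s_0>0$ such that $M(\lambda s)/M(s)\ge c\lambda^\alpha$ for all $\lambda\ge1$ and $s\ge s_0$ (in particular $M(s)\to\infty$ as $s\to\infty$). For a continuous non-decreasing function $M\colon[a,\infty)\to(0,\infty)$ with $M(s)\to\infty$ as $s\to\infty$, $M^{-1}$ denotes its right-continuous right-inverse $M^{-1}(t)=\sup\{r\ge a: M(r)\le t\}$, $t\ge M(a)$. $f(t)=O(g(t))$, $t\to\infty$, means there is a constant $C>0$ with $f(t)\le Cg(t)$ for all sufficiently large $t$. *)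

theory Defs
  imports "HOL-Analysis.Analysis" "HOL-Library.Landau_Symbols"
begin

text \<open>
  The inner product is linear in its first argument. Positivity and definiteness follow from
  \<open>cinner_self\<close> and the norm axioms of \<^class>\<open>banach\<close>. The real vector space structure of
  \<^class>\<open>banach\<close> is the one obtained by restriction of scalars, so the library's notions for
  real normed spaces (such as \<^const>\<open>bounded_linear\<close> and \<^const>\<open>onorm\<close>) apply.
\<close>

class complex_hilbert = banach +
  fixes scaleC :: "complex \<Rightarrow> 'a \<Rightarrow> 'a" (infixr "*\<^sub>C" 75)
    and cinner :: "'a \<Rightarrow> 'a \<Rightarrow> complex"
  assumes scaleC_add_right: "c *\<^sub>C (x + y) = c *\<^sub>C x + c *\<^sub>C y"
    and scaleC_add_left: "(c + d) *\<^sub>C x = c *\<^sub>C x + d *\<^sub>C x"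
    and scaleC_scaleC: "c *\<^sub>C (d *\<^sub>C x) = (c * d) *\<^sub>C x"
    and scaleC_of_real: "complex_of_real r *\<^sub>C x = r *\<^sub>R x"
    and cinner_commute: "cinner x y = cnj (cinner y x)"
    and cinner_add_left: "cinner (x + y) z = cinner x z + cinner y z"
    and cinner_scaleC_left: "cinner (c *\<^sub>C x) y = c * cinner x y"
    and cinner_self: "cinner x x = complex_of_real ((norm x)\<^sup>2)"

instantiation complex :: complex_hilbert
begin

definition scaleC_complex :: "complex \<Rightarrow> complex \<Rightarrow> complex"
  where "scaleC_complex c x = c * x"

definition cinner_complex :: "complex \<Rightarrow> complex \<Rightarrow> complex"
  where "cinner_complex x y = x * cnj y"

instance
  by standard
    (simp_all add: scaleC_complex_def cinner_complex_def algebra_simps scaleR_conv_of_real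
      flip: complex_norm_square)

end

definition bounded_clinear :: "('a::complex_hilbert \<Rightarrow> 'a) \<Rightarrow> bool"
  where "bounded_clinear f \<longleftrightarrow> bounded_linear f \<and> (\<forall>c x. f (c *\<^sub>C x) = c *\<^sub>C f x)"

text \<open>Only the values \<open>T t\<close> with \<open>t \<ge> 0\<close> matter here and below.\<close>

definition C0_semigroup :: "(real \<Rightarrow> 'a::complex_hilbert \<Rightarrow> 'a) \<Rightarrow> bool"
  where "C0_semigroup T \<longleftrightarrow>
    (\<forall>t\<ge>0. bounded_clinear (T t)) \<and>
    (\<forall>x. T 0 x = x) \<and>
    (\<forall>s\<ge>0. \<forall>t\<ge>0. \<forall>x. T (s + t) x = T s (T t x)) \<and>
    (\<forall>x. continuous_on {0..} (\<lambda>t. T t x))"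

definition bounded_semigroup :: "(real \<Rightarrow> 'a::complex_hilbert \<Rightarrow> 'a) \<Rightarrow> bool"
  where "bounded_semigroup T \<longleftrightarrow> bdd_above ((\<lambda>t. onorm (T t)) ` {0..})"

text \<open>
  An unbounded operator is given by its domain \<open>D\<close> together with a function \<open>A\<close> whose values
  outside \<open>D\<close> are irrelevant.
\<close>

definition is_generator ::
    "(real \<Rightarrow> 'a::complex_hilbert \<Rightarrow> 'a) \<Rightarrow> 'a set \<Rightarrow> ('a \<Rightarrow> 'a) \<Rightarrow> bool"
  where "is_generator T D A \<longleftrightarrow>
    D = {x. \<exists>y. ((\<lambda>t. (T t x - x) /\<^sub>R t) \<longlongrightarrow> y) (at_right 0)} \<and>
    (\<forall>x\<in>D. ((\<lambda>t. (T t x - x) /\<^sub>R t) \<longlongrightarrow> A x) (at_right 0))"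

definition resolvent :: "'a::complex_hilbert set \<Rightarrow> ('a \<Rightarrow> 'a) \<Rightarrow> complex \<Rightarrow> 'a \<Rightarrow> 'a"
  where "resolvent D A z = inv_into D (\<lambda>x. z *\<^sub>C x - A x)"

definition spectrum :: "'a::complex_hilbert set \<Rightarrow> ('a \<Rightarrow> 'a) \<Rightarrow> complex set"
  where "spectrum D A =
    {z. \<not> (bij_betw (\<lambda>x. z *\<^sub>C x - A x) D UNIV \<and> bounded_clinear (resolvent D A z))}"

definition positive_increase :: "real \<Rightarrow> (real \<Rightarrow> real) \<Rightarrow> bool"
  where "positive_increase a M \<longleftrightarrow>
    0 \<le> a \<and> M \<in> borel_measurable (lebesgue_on {a..}) \<and> (\<forall>s\<ge>a. 0 < M s) \<and>
    (\<exists>\<alpha> c s\<^sub>0. 0 < \<alpha> \<and> 0 < c \<and> c \<le> 1 \<and> a \<le> s\<^sub>0 \<and> 0 < s\<^sub>0 \<and>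
      (\<forall>l\<ge>1. \<forall>s\<ge>s\<^sub>0. M (l * s) / M s \<ge> c * l powr \<alpha>))"

text \<open>
  Meaningful for \<open>t \<ge> M a\<close> and \<open>M\<close> tending to infinity; the set below is then nonempty and bounded.
\<close>

definition right_inverse :: "real \<Rightarrow> (real \<Rightarrow> real) \<Rightarrow> real \<Rightarrow> real"
  where "right_inverse a M t = Sup {r. a \<le> r \<and> M r \<le> t}"

end

theory Submission imports Defs
begin

text \<open>
  Put \<open>R = M\<inverse>(t)\<close>, \<open>P = A\<inverse>\<close>, \<open>z = 1/t + i s\<close> and fix \<open>p\<close> with \<open>p \<alpha> \<ge> 1\<close>. Up to a constant, the function
  \<open>\<tau> \<mapsto> \<tau>\<^sup>p e\<^bsup>-\<tau>/t\<^esup> T(\<tau>) P y\<close> has Fourier transform \<open>R(z,A)\<^sup>p P\<close> applied to that of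
  \<open>\<tau> \<mapsto> e\<^bsup>-\<tau>/t\<^esup> T(\<tau>) y\<close>, so by Plancherel \<open>t\<^sup>p \<parallel>T(t) P\<parallel>\<close> is at most a constant times
  \<open>sup\<^sub>s \<parallel>R(z,A)\<^sup>p P\<parallel>\<close>. For \<open>\<bar>s\<bar> \<ge> R\<close> the bounds \<open>\<parallel>R(z,A)\<parallel> = O(t)\<close> and
  \<open>\<parallel>R(z,A) P\<parallel> = O(t/\<bar>s\<bar>)\<close> give \<open>O(t\<^sup>p/R)\<close>; for \<open>\<bar>s\<bar> \<le> R\<close> one has \<open>O(M(\<bar>s\<bar>)\<^sup>p/\<bar>s\<bar>)\<close>, which is
  \<open>O(t\<^sup>p/R)\<close> by positive increase.

  To avoid vector-valued integrals and the resolvent off the imaginary axis, time is discretised with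
  a small step \<open>h\<close>: the operator \<open>Q = h (I - e\<^bsup>-zh\<^esup> T(h))\<inverse>\<close>, given by its Neumann series, replaces
  \<open>R(z,A)\<close>, and Plancherel reduces to Parseval's identity for the finite Fourier transform. For fixed
  \<open>t\<close> the discretisation error is \<open>O(h)\<close> on \<open>\<bar>s\<bar> \<le> R\<close>, and larger frequencies need no approximation.
\<close>

section \<open>Parseval's inequality for summable sequences\<close>

lemma norm_scaleC: "norm (c *\<^sub>C x) = cmod c * norm (x::'a::complex_hilbert)"
proof -
  \<comment> \<open>The class postulates homogeneity of the norm over the reals only; the complex
    case comes from \<open>cinner_self\<close>.\<close>
  have "cinner (c *\<^sub>C x) (c *\<^sub>C x) = c * cnj c * cinner x x"
    by (metis (no_types) cinner_commute cinner_scaleC_left complex_cnj_mult mult.assoc)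
  hence "complex_of_real ((norm (c *\<^sub>C x))\<^sup>2) = complex_of_real ((cmod c * norm x)\<^sup>2)"
    by (simp only: cinner_self power_mult_distrib of_real_mult complex_norm_square)
  hence "(norm (c *\<^sub>C x))\<^sup>2 = (cmod c * norm x)\<^sup>2"
    using of_real_eq_iff by blast
  thus ?thesis by (simp add: power2_eq_iff_nonneg)
qed

lemma scaleC_one [simp]: "1 *\<^sub>C x = (x::'a::complex_hilbert)"
  using scaleC_of_real[of 1 x] by simp

lemma scaleC_zero_left [simp]: "0 *\<^sub>C x = (0::'a::complex_hilbert)"
  using scaleC_of_real[of 0 x] by simp

lemma scaleC_scaleR: "c *\<^sub>C (r *\<^sub>R x) = r *\<^sub>R (c *\<^sub>C (x::'a::complex_hilbert))"
  by (simp add: scaleC_scaleC mult.commute flip: scaleC_of_real)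

lemma bounded_bilinear_scaleC: "bounded_bilinear (scaleC :: complex \<Rightarrow> 'a::complex_hilbert \<Rightarrow> 'a)"
proof
  show "(r *\<^sub>R c) *\<^sub>C x = r *\<^sub>R (c *\<^sub>C x)" for r :: real and c and x :: 'a
    by (simp add: scaleR_conv_of_real scaleC_scaleC flip: scaleC_of_real)
  show "\<exists>K. \<forall>c (x::'a). norm (c *\<^sub>C x) \<le> norm c * norm x * K"
    by (rule exI[of _ 1]) (simp add: norm_scaleC)
qed (simp_all add: scaleC_add_left scaleC_add_right scaleC_scaleR)

lemmas bounded_linear_scaleC = bounded_bilinear.bounded_linear_right[OF bounded_bilinear_scaleC]
lemmas tendsto_scaleC = bounded_bilinear.tendsto[OF bounded_bilinear_scaleC]
lemmas scaleC_diff_right = bounded_bilinear.diff_right[OF bounded_bilinear_scaleC]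
lemmas scaleC_diff_left = bounded_bilinear.diff_left[OF bounded_bilinear_scaleC]
lemmas scaleC_minus_left = bounded_bilinear.minus_left[OF bounded_bilinear_scaleC]
lemmas scaleC_minus_right = bounded_bilinear.minus_right[OF bounded_bilinear_scaleC]

lemma cinner_sum_left: "cinner (\<Sum>i\<in>I. f i) y = (\<Sum>i\<in>I. cinner (f i) (y::'a::complex_hilbert))"
proof (rule sum_comp_morphism[of "\<lambda>x. cinner x y", unfolded o_def, symmetric])
  show "cinner 0 y = 0" using cinner_scaleC_left[of 0 0 y] by simp
qed (rule cinner_add_left)

lemma cinner_sum_right: "cinner x (\<Sum>i\<in>I. f i) = (\<Sum>i\<in>I. cinner x (f i :: 'a::complex_hilbert))"
  by (subst cinner_commute, subst cinner_sum_left) (simp add: cinner_commute[of x])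

lemma cinner_scaleC_right: "cinner x (c *\<^sub>C y) = cnj c * cinner x (y::'a::complex_hilbert)"
  by (metis cinner_commute cinner_scaleC_left complex_cnj_mult)

text \<open>Orthogonality of the characters of Z/N. For \<open>n \<noteq> m\<close> the sum is
  geometric; its ratio \<open>cis \<theta>\<close> is an N-th root of unity and differs from 1
  because \<open>0 < \<bar>n - m\<bar> < N\<close>.\<close>

lemma sum_roots_of_unity:
  fixes N n m :: nat
  assumes "n < N" "m < N"
  defines "\<omega> \<equiv> \<lambda>j::nat. cis (2 * pi * j / N)"
  shows "(\<Sum>j<N. \<omega> j ^ n * cnj (\<omega> j ^ m)) = (if n = m then of_nat N else 0)"
proof -
  define \<theta> where "\<theta> = 2 * pi * (real n - real m) / N"
  have e: "\<omega> j ^ n * cnj (\<omega> j ^ m) = cis \<theta> ^ j" for j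
    by (simp add: \<omega>_def \<theta>_def Complex.DeMoivre cis_cnj cis_mult diff_divide_distrib algebra_simps)
  show ?thesis
  proof (cases "n = m")
    case True
    hence "\<theta> = 0" by (simp add: \<theta>_def)
    thus ?thesis unfolding e using True by simp
  next
    case False
    have "cis \<theta> \<noteq> 1"
    proof
      assume "cis \<theta> = 1"
      hence "cos \<theta> = 1" by (metis cis.sel(1) one_complex.sel(1))
      then obtain k :: int where k: "\<theta> = k * 2 * pi" by (auto simp: cos_one_2pi_int)
      hence "real n - real m = k * N" using assms(1)
        by (simp add: \<theta>_def divide_simps)
      hence "int n - int m = k * int N"
        by (metis of_int_diff of_int_eq_iff of_int_mult of_int_of_nat_eq)
      moreover have "\<bar>int n - int m\<bar> < int N" using assms by linarith
      ultimately have "int n - int m = 0"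
        using dvd_imp_le_int[of "int n - int m" "int N"] by fastforce
      thus False using False by simp
    qed
    moreover have "cis \<theta> ^ N = 1"
    proof -
      have "cis \<theta> ^ N = cis (2 * pi * of_int (int n - int m))"
        using assms by (simp add: Complex.DeMoivre \<theta>_def)
      thus ?thesis by (metis cis_multiple_2pi Ints_of_int)
    qed
    ultimately show ?thesis unfolding e using False by (simp add: sum_gp_strict)
  qed
qed

text \<open>Expanding the inner products and summing over \<open>j\<close> first leaves, by
  \<open>sum_roots_of_unity\<close>, only the diagonal terms.\<close>

lemma dft_parseval:
  fixes f :: "nat \<Rightarrow> 'a::complex_hilbert"
  defines "\<omega> \<equiv> \<lambda>(N::nat) (j::nat). cis (2 * pi * j / N)"
  shows "(\<Sum>j<N. (norm (\<Sum>n<N. \<omega> N j ^ n *\<^sub>C f n))\<^sup>2) = N * (\<Sum>n<N. (norm (f n))\<^sup>2)"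
proof -
  have "complex_of_real (\<Sum>j<N. (norm (\<Sum>n<N. \<omega> N j ^ n *\<^sub>C f n))\<^sup>2)
    = (\<Sum>j<N. \<Sum>m<N. \<Sum>n<N. cinner (f n) (f m) * (\<omega> N j ^ n * cnj (\<omega> N j ^ m)))"
    by (simp only: of_real_sum flip: cinner_self)
       (simp add: cinner_sum_left cinner_sum_right cinner_scaleC_left cinner_scaleC_right
         sum_distrib_left mult_ac)
  also have "\<dots> = (\<Sum>m<N. \<Sum>j<N. \<Sum>n<N. cinner (f n) (f m) * (\<omega> N j ^ n * cnj (\<omega> N j ^ m)))"
    by (rule sum.swap)
  also have "\<dots> = (\<Sum>m<N. \<Sum>n<N. \<Sum>j<N. cinner (f n) (f m) * (\<omega> N j ^ n * cnj (\<omega> N j ^ m)))"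
    by (intro sum.cong refl sum.swap)
  also have "\<dots> = (\<Sum>m<N. \<Sum>n<N. cinner (f n) (f m) * (if n = m then of_nat N else 0))"
    unfolding \<omega>_def by (intro sum.cong refl, subst sum_distrib_left[symmetric], subst sum_roots_of_unity) auto
  also have "\<dots> = complex_of_real (N * (\<Sum>n<N. (norm (f n))\<^sup>2))"
    by (simp add: if_distrib[of "\<lambda>x. _ * x"] cinner_self sum_distrib_left mult_ac cong: if_cong)
  finally show ?thesis using of_real_eq_iff by blast
qed

lemma norm_suminf_diff_le:
  fixes f :: "nat \<Rightarrow> 'a::banach"
  assumes "summable (\<lambda>n. norm (f n))"
  shows "norm ((\<Sum>n. f n) - (\<Sum>n<N. f n)) \<le> (\<Sum>n. norm (f n)) - (\<Sum>n<N. norm (f n))"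
proof -
  have "(\<Sum>n. f n) - (\<Sum>n<N. f n) = (\<Sum>n. f (n + N))"
    by (simp add: suminf_minus_initial_segment summable_norm_cancel assms)
  also have "norm \<dots> \<le> (\<Sum>n. norm (f (n + N)))"
    using assms by (intro summable_norm) (subst summable_iff_shift)
  also have "\<dots> = (\<Sum>n. norm (f n)) - (\<Sum>n<N. norm (f n))"
    by (rule suminf_minus_initial_segment) fact
  finally show ?thesis .
qed

text \<open>Stands in for Plancherel's theorem. Truncating both series after \<open>N\<close> terms
  and sampling at the N-th roots of unity makes \<open>dft_parseval\<close> applicable. By absolute
  summability the truncation errors are uniform on the unit circle; over \<open>N\<close> sample
  points they contribute the same factor \<open>sqrt N\<close> as the main terms, so it cancels and
  the errors vanish in the limit.\<close>

lemma l2_bound_of_transform_bound: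
  fixes f g :: "nat \<Rightarrow> 'a::complex_hilbert"
  assumes f: "summable (\<lambda>n. norm (f n))" and g: "summable (\<lambda>n. norm (g n))"
    and S: "S \<ge> 0"
    and le: "\<And>\<zeta>. cmod \<zeta> = 1 \<Longrightarrow> norm (\<Sum>n. \<zeta> ^ n *\<^sub>C f n) \<le> S * norm (\<Sum>n. \<zeta> ^ n *\<^sub>C g n)"
    and b: "\<And>N. (\<Sum>n<N. (norm (g n))\<^sup>2) \<le> B"
  shows "(\<Sum>n<N. (norm (f n))\<^sup>2) \<le> S\<^sup>2 * B"
proof -
  define \<delta> where "\<delta> = (\<lambda>(f::nat \<Rightarrow> 'a) N. (\<Sum>n. norm (f n)) - (\<Sum>n<N. norm (f n)))"
  have tail: "norm ((\<Sum>n. \<zeta> ^ n *\<^sub>C f n) - (\<Sum>n<N. \<zeta> ^ n *\<^sub>C f n)) \<le> \<delta> f N"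
    if "cmod \<zeta> = 1" "summable (\<lambda>n. norm (f n))" for \<zeta> N and f :: "nat \<Rightarrow> 'a"
    using norm_suminf_diff_le[of "\<lambda>n. \<zeta> ^ n *\<^sub>C f n" N] that
    by (simp add: \<delta>_def norm_scaleC norm_power)
  have \<delta>0: "\<delta> f \<longlonglongrightarrow> 0" if "summable (\<lambda>n. norm (f n))" for f
    using tendsto_diff[OF tendsto_const summable_LIMSEQ[OF that], of "\<Sum>n. norm (f n)"]
    by (simp add: \<delta>_def)
  have main: "L2_set (\<lambda>n. norm (f n)) {..<N} \<le> S * sqrt B + (S * \<delta> g N + \<delta> f N)" if "N > 0" for N
  proof -
    define \<omega> where "\<omega> j = cis (2 * pi * real j / real N)" for j
    define F where "F = (\<lambda>(f::nat \<Rightarrow> 'a) j. norm (\<Sum>n<N. \<omega> j ^ n *\<^sub>C f n))"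
    have P: "L2_set (F f) {..<N} = sqrt N * L2_set (\<lambda>n. norm (f n)) {..<N}" for f
      using dft_parseval[of N f] by (simp add: L2_set_def F_def \<omega>_def real_sqrt_mult)
    have FfFg: "F f j \<le> S * F g j + (S * \<delta> g N + \<delta> f N)" for j
    proof -
      have w: "cmod (\<omega> j) = 1" by (simp add: \<omega>_def)
      have 1: "F f j \<le> norm (\<Sum>n. \<omega> j ^ n *\<^sub>C f n) + \<delta> f N"
        unfolding F_def using tail[OF w f, of N] by norm
      have 2: "norm (\<Sum>n. \<omega> j ^ n *\<^sub>C g n) \<le> F g j + \<delta> g N"
        unfolding F_def using tail[OF w g, of N] by norm
      show ?thesis using 1 le[OF w] mult_left_mono[OF 2 S] by (simp add: algebra_simps)
    qed
    have c0: "S * \<delta> g N + \<delta> f N \<ge> 0"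
      using tail[of 1, OF _ f, of N] tail[of 1, OF _ g, of N] S
      by (metis add_nonneg_nonneg mult_nonneg_nonneg norm_ge_zero norm_one order_trans)
    have "sqrt N * L2_set (\<lambda>n. norm (f n)) {..<N} = L2_set (F f) {..<N}" by (simp add: P)
    also have "\<dots> \<le> L2_set (\<lambda>j. S * F g j + (S * \<delta> g N + \<delta> f N)) {..<N}"
      by (rule L2_set_mono) (use FfFg in \<open>auto simp: F_def\<close>)
    also have "\<dots> \<le> L2_set (\<lambda>j. S * F g j) {..<N} + L2_set (\<lambda>j. S * \<delta> g N + \<delta> f N) {..<N}"
      by (rule L2_set_triangle_ineq)
    also have "L2_set (\<lambda>j. S * F g j) {..<N} = S * (sqrt N * L2_set (\<lambda>n. norm (g n)) {..<N})"
      by (simp add: P[symmetric] L2_set_right_distrib S)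
    also have "L2_set (\<lambda>j. S * \<delta> g N + \<delta> f N) {..<N} = sqrt N * (S * \<delta> g N + \<delta> f N)"
      using c0 by (simp add: L2_set_def real_sqrt_mult)
    finally have "sqrt N * L2_set (\<lambda>n. norm (f n)) {..<N}
        \<le> sqrt N * (S * L2_set (\<lambda>n. norm (g n)) {..<N} + (S * \<delta> g N + \<delta> f N))"
      by (simp add: algebra_simps)
    hence "L2_set (\<lambda>n. norm (f n)) {..<N}
        \<le> S * L2_set (\<lambda>n. norm (g n)) {..<N} + (S * \<delta> g N + \<delta> f N)"
      using that by simp
    moreover have "S * L2_set (\<lambda>n. norm (g n)) {..<N} \<le> S * sqrt B"
      unfolding L2_set_def by (intro mult_left_mono S real_sqrt_le_mono b)
    ultimately show ?thesis by linarith
  qed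
  \<comment> \<open>\<open>main\<close> couples the number of terms with the truncation index; by
    monotonicity the former stays at \<open>N\<close> while the latter tends to infinity.\<close>
  have "L2_set (\<lambda>n. norm (f n)) {..<N} \<le> S * sqrt B + (S * \<delta> g k + \<delta> f k)" if "k > N" for k
  proof -
    have "L2_set (\<lambda>n. norm (f n)) {..<N} \<le> L2_set (\<lambda>n. norm (f n)) {..<k}"
      unfolding L2_set_def using that by (intro real_sqrt_le_mono sum_mono2) auto
    also note main[of k]
    finally show ?thesis using that by simp
  qed
  moreover have "(\<lambda>k. S * sqrt B + (S * \<delta> g k + \<delta> f k)) \<longlonglongrightarrow> S * sqrt B + (S * 0 + 0)"
    by (intro tendsto_intros \<delta>0 f g)
  ultimately have le: "L2_set (\<lambda>n. norm (f n)) {..<N} \<le> S * sqrt B"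
    by (intro LIMSEQ_le_const[where X="\<lambda>k. S * sqrt B + (S * \<delta> g k + \<delta> f k)"])
       (auto intro!: exI[of _ "Suc N"])
  have "B \<ge> 0" using b[of 0] by simp
  hence "(L2_set (\<lambda>n. norm (f n)) {..<N})\<^sup>2 \<le> S\<^sup>2 * B"
    using power_mono[OF le L2_set_nonneg, of 2] by (simp add: power_mult_distrib)
  thus ?thesis by (simp add: L2_set_def sum_nonneg)
qed

section \<open>Powers of the Neumann series\<close>

text \<open>Ratio test: consecutive terms have quotient \<open>(1 + p / (n + 1)) * r\<close>, which
  tends to \<open>r\<close>.\<close>

lemma summable_binomial_power:
  fixes r :: real
  assumes "0 \<le> r" "r < 1"
  shows "summable (\<lambda>n. real ((n + p) choose p) * r ^ n)"
proof (cases "r = 0")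
  case False
  hence r: "r > 0" using assms by simp
  have lim: "(\<lambda>n. (1 + real p / real (Suc n)) * r) \<longlonglongrightarrow> (1 + 0) * r"
    by (intro tendsto_intros LIMSEQ_Suc lim_const_over_n)
  obtain c where c: "r < c" "c < 1" using dense assms by blast
  hence "\<forall>\<^sub>F n in sequentially. (1 + real p / real (Suc n)) * r < c"
    using order_tendstoD(2)[OF lim, of c] by simp
  then obtain N where N: "\<And>n. n \<ge> N \<Longrightarrow> (1 + real p / real (Suc n)) * r < c"
    by (auto simp: eventually_sequentially)
  have step: "real ((Suc n + p) choose p) = (1 + real p / real (Suc n)) * real ((n + p) choose p)" for n
  proof -
    have "Suc n * ((Suc n + p) choose p) = Suc (n + p) * ((n + p) choose p)"
      using Suc_times_binomial_eq[of "n + p" n] binomial_symmetric[of p "Suc n + p"]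
        binomial_symmetric[of p "n + p"] by (simp add: mult.commute)
    hence "real (Suc n) * real ((Suc n + p) choose p) = real (Suc (n + p)) * real ((n + p) choose p)"
      by (metis of_nat_mult)
    thus ?thesis by (simp add: field_simps)
  qed
  show ?thesis
  proof (rule summable_ratio_test[OF c(2), of N])
    fix n assume n: "n \<ge> N"
    have "real ((Suc n + p) choose p) * r ^ Suc n
        = ((1 + real p / real (Suc n)) * r) * (real ((n + p) choose p) * r ^ n)"
      by (simp only: step power_Suc) (simp only: mult_ac)
    also have "\<dots> \<le> c * (real ((n + p) choose p) * r ^ n)"
      using N[OF n] r by (intro mult_right_mono) auto
    finally show "norm (real ((Suc n + p) choose p) * r ^ Suc n)
        \<le> c * norm (real ((n + p) choose p) * r ^ n)"
      using r by (simp del: binomial_Suc_Suc of_nat_Suc add_Suc)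
  qed
qed (auto intro!: summable_finite[of "{0}"])

definition neumann :: "('a \<Rightarrow> 'a) \<Rightarrow> 'a \<Rightarrow> 'a::real_normed_vector"
  where "neumann G x = (\<Sum>n. (G ^^ n) x)"

text \<open>The geometric bound is imposed on all powers, with a constant \<open>K\<close>, because
  \<open>K * r\<close> may exceed 1: one step of a bounded semigroup need not be a strict
  contraction, even after damping.\<close>

locale power_decay =
  fixes G :: "'a::banach \<Rightarrow> 'a" and K r :: real
  assumes blin: "bounded_linear G"
    and r: "0 \<le> r" "r < 1"
    and decay: "norm ((G ^^ n) x) \<le> K * r ^ n * norm x"
begin

lemma bounded_linear_funpow: "bounded_linear (G ^^ n)"
proof (induction n)
  case (Suc n)
  show ?case using bounded_linear_compose[OF blin Suc] by (simp add: comp_def)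
qed (simp add: id_def bounded_linear_ident)

lemma summable_norm_binomial: "summable (\<lambda>n. norm (real ((n + p) choose p) *\<^sub>R (G ^^ n) x))"
proof (rule summable_comparison_test_ev)
  show "summable (\<lambda>n. (K * norm x) * (real ((n + p) choose p) * r ^ n))"
    by (intro summable_mult summable_binomial_power r)
  show "\<forall>\<^sub>F n in sequentially. norm (norm (real ((n + p) choose p) *\<^sub>R (G ^^ n) x))
      \<le> K * norm x * (real ((n + p) choose p) * r ^ n)"
    using mult_left_mono[OF decay, of "real ((_ + p) choose p)"]
    by (intro always_eventually allI) (simp add: mult_ac)
qed

lemma summable_funpow: "summable (\<lambda>n. (G ^^ n) x)"
  using summable_norm_binomial[of 0] by (simp add: summable_norm_cancel)

lemma norm_neumann_le: "norm (neumann G x) \<le> K / (1 - r) * norm x"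
proof -
  have "norm (neumann G x) \<le> (\<Sum>n. norm ((G ^^ n) x))"
    unfolding neumann_def using summable_norm_binomial[of 0] by (intro summable_norm) simp
  also have "\<dots> \<le> (\<Sum>n. K * norm x * r ^ n)"
    using summable_norm_binomial[of 0 x] r decay[of _ x]
    by (intro suminf_le summable_mult summable_geometric) (auto simp: mult_ac)
  also have "\<dots> = K * norm x * (1 / (1 - r))"
    using r by (subst suminf_mult) (auto simp: suminf_geometric)
  finally show ?thesis by simp
qed

lemma neumann_commute:
  assumes B: "bounded_linear B" and c: "\<And>x. B (G x) = G (B x)"
  shows "B (neumann G x) = neumann G (B x)"
proof -
  have "B ((G ^^ n) x) = (G ^^ n) (B x)" for n by (induction n) (simp_all add: c)
  thus ?thesis
    unfolding neumann_def by (simp add: bounded_linear.suminf[OF B summable_funpow])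
qed

lemma bounded_linear_neumann: "bounded_linear (neumann G)"
proof (rule bounded_linear_intro)
  fix x y :: 'a and c :: real
  interpret G: bounded_linear "G ^^ n" for n by (rule bounded_linear_funpow)
  show "neumann G (x + y) = neumann G x + neumann G y"
    by (simp add: neumann_def G.add suminf_add[OF summable_funpow summable_funpow])
  show "neumann G (c *\<^sub>R x) = c *\<^sub>R neumann G x"
    by (simp add: neumann_def G.scaleR suminf_scaleR_right summable_funpow)
  show "norm (neumann G x) \<le> norm x * (K / (1 - r))"
    using norm_neumann_le[of x] by (simp add: mult.commute)
qed

lemma neumann_diff: "neumann G (x - G x) = x"
proof -
  interpret N: bounded_linear "neumann G" by (rule bounded_linear_neumann)
  have "neumann G x = x + neumann G (G x)"
    using suminf_split_head[OF summable_funpow, of x] by (simp add: neumann_def funpow_swap1)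
  thus ?thesis by (simp add: N.diff)
qed

text \<open>The binomial series of \<open>(I - G)\<close> to the power \<open>-(p + 1)\<close>.
  Applying \<open>I - G\<close> to the series for \<open>p + 1\<close> gives the series for
  \<open>p\<close> by Pascal's rule. The binomial weights, times \<open>h ^ p\<close>, are the
  discrete counterpart of the weight \<open>\<tau>^p / p!\<close> in time.\<close>

lemma neumann_power_sums:
  "(\<lambda>n. real ((n + p) choose p) *\<^sub>R (G ^^ n) x) sums ((neumann G ^^ Suc p) x)"
proof (induction p)
  case 0
  show ?case using summable_sums[OF summable_funpow] by (simp add: neumann_def)
next
  case (Suc p)
  define f where "f = (\<lambda>p n. real ((n + p) choose p) *\<^sub>R (G ^^ n) x)"
  interpret G: bounded_linear G by (rule blin)
  obtain s where s: "f (Suc p) sums s"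
    using summable_sums[OF summable_norm_cancel[OF summable_norm_binomial]] unfolding f_def by blast
  \<comment> \<open>The term of index 0 is \<open>x\<close>. Dropping it aligns the series with its
    image under \<open>G\<close>, so that Pascal's rule applies term by term.\<close>
  have "(\<lambda>n. f (Suc p) (Suc n)) sums (s - x)"
    using s sums_Suc_iff[of "f (Suc p)" "s - x"] by (simp add: f_def del: binomial_Suc_Suc)
  hence "(\<lambda>n. f (Suc p) (Suc n) - G (f (Suc p) n)) sums (s - x - G s)"
    using G.sums[OF s] by (rule sums_diff)
  moreover have "f (Suc p) (Suc n) - G (f (Suc p) n) = f p (Suc n)" for n
    by (simp add: f_def G.scaleR scaleR_left_diff_distrib[symmetric])
  ultimately have "(\<lambda>n. f p (Suc n)) sums (s - x - G s)" by simp
  hence "f p sums (s - G s)"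
    using sums_Suc_iff[of "f p" "s - x - G s"] by (simp add: f_def)
  moreover have "f p sums ((neumann G ^^ Suc p) x)" using Suc.IH by (simp add: f_def)
  ultimately have "s - G s = (neumann G ^^ Suc p) x" by (rule sums_unique2)
  hence "neumann G ((neumann G ^^ Suc p) x) = s" using neumann_diff[of s] by simp
  thus ?case using s by (simp add: f_def)
qed

end

text \<open>Telescoping: the difference of the powers \<open>n + 1\<close> is \<open>Q\<close>
  applied to the difference of the powers \<open>n\<close>, plus \<open>B ^^ n\<close> applied to
  \<open>Q x - B x\<close>. Commutativity is what makes an error bound at the single vector
  \<open>x\<close> sufficient, without closeness of \<open>Q\<close> and \<open>B\<close> in
  operator norm.\<close>

lemma norm_funpow_diff_le:
  fixes Q B :: "'a::real_normed_vector \<Rightarrow> 'a"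
  assumes Q: "linear Q" and B: "linear B" and com: "\<And>x. Q (B x) = B (Q x)"
    and nQ: "\<And>x. norm (Q x) \<le> d * norm x" and nB: "\<And>x. norm (B x) \<le> d * norm x"
    and d: "d \<ge> 1" and e: "norm (Q x - B x) \<le> e"
  shows "norm ((Q ^^ n) x - (B ^^ n) x) \<le> n * d ^ n * e"
proof (induction n)
  case (Suc n)
  have e0: "e \<ge> 0" using e norm_ge_zero order_trans by blast
  have nBn: "norm ((B ^^ n) y) \<le> d ^ n * norm y" for n y
  proof (induction n)
    case (Suc n)
    have "norm (B ((B ^^ n) y)) \<le> d * norm ((B ^^ n) y)" by (rule nB)
    also have "\<dots> \<le> d * (d ^ n * norm y)" using d Suc by (intro mult_left_mono) auto
    finally show ?case by (simp add: mult_ac)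
  qed simp
  have lin: "(B ^^ n) (y - z) = (B ^^ n) y - (B ^^ n) z" for n y z
    by (induction n) (simp_all add: linear_diff[OF B])
  have QB: "Q ((B ^^ n) y) = (B ^^ n) (Q y)" for n y by (induction n) (simp_all add: com)
  have "(Q ^^ Suc n) x - (B ^^ Suc n) x = Q ((Q ^^ n) x - (B ^^ n) x) + (B ^^ n) (Q x - B x)"
    by (simp add: linear_diff[OF Q] lin QB funpow_swap1)
  also have "norm \<dots> \<le> d * (n * d ^ n * e) + d ^ n * e"
  proof (intro norm_triangle_mono)
    show "norm (Q ((Q ^^ n) x - (B ^^ n) x)) \<le> d * (n * d ^ n * e)"
      using nQ[of "(Q ^^ n) x - (B ^^ n) x"] mult_left_mono[OF Suc, of d] d by linarith
    show "norm ((B ^^ n) (Q x - B x)) \<le> d ^ n * e"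
      using nBn[of n "Q x - B x"] mult_left_mono[OF e, of "d ^ n"] d
      by (elim order_trans) simp
  qed
  also have "\<dots> \<le> d * (n * d ^ n * e) + d ^ Suc n * e"
    using d e0 by (intro add_left_mono mult_right_mono power_increasing) auto
  also have "\<dots> = Suc n * d ^ Suc n * e" by (simp add: algebra_simps)
  finally show ?case .
qed simp

lemma funpow_compose_commute:
  assumes "\<And>x. f (g x) = g (f x)"
  shows "((\<lambda>x. f (g x)) ^^ n) x = (f ^^ n) ((g ^^ n) x)"
proof (induction n)
  case (Suc n)
  have "g ((f ^^ n) y) = (f ^^ n) (g y)" for y by (induction n) (simp_all add: assms[symmetric])
  thus ?case using Suc by simp
qed simp

section \<open>Generators and resolvents on the imaginary axis\<close>

text \<open>Covers both \<open>T\<close> and its damped versions \<open>e^(-zt) T(t)\<close>, so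
  that the first and second order step estimates are proved once.\<close>

locale bounded_additive_family =
  fixes S :: "real \<Rightarrow> 'a::real_normed_vector \<Rightarrow> 'a" and K :: real
  assumes S_linear: "t \<ge> 0 \<Longrightarrow> linear (S t)"
    and S_0: "S 0 x = x"
    and S_add: "s \<ge> 0 \<Longrightarrow> t \<ge> 0 \<Longrightarrow> S (s + t) x = S s (S t x)"
    and S_bound: "t \<ge> 0 \<Longrightarrow> norm (S t x) \<le> K * norm x"
begin

lemma S_funpow: "h \<ge> 0 \<Longrightarrow> (S h ^^ n) x = S (n * h) x"
  by (induction n) (simp_all add: S_0 S_add[symmetric] distrib_right)

lemma S_telescope:
  fixes n :: nat and h :: real
  assumes "h \<ge> 0"
  shows "S (n * h) x - x = (\<Sum>i<n. S (i * h) (S h x - x))"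
proof (induction n)
  case 0
  show ?case by (simp add: S_0)
next
  case (Suc n)
  have "S (Suc n * h) x - x = S (n * h) (S h x) - S (n * h) x + (S (n * h) x - x)"
    using assms by (simp add: S_add[symmetric] algebra_simps)
  also have "S (n * h) (S h x) - S (n * h) x = S (n * h) (S h x - x)"
    using assms by (simp add: linear_diff[OF S_linear])
  finally show ?case using Suc by simp
qed

lemma tendsto_step:
  assumes "(f \<longlongrightarrow> (l::'b::topological_space)) (at_right 0)" and "h > (0::real)"
  shows "(\<lambda>n. f (h / real (Suc n))) \<longlonglongrightarrow> l"
proof (rule filterlim_compose[OF assms(1)])
  have "(\<lambda>n. h / real (Suc n)) \<longlonglongrightarrow> 0" by (rule LIMSEQ_Suc[OF lim_const_over_n])
  thus "filterlim (\<lambda>n. h / real (Suc n)) (at_right 0) sequentially"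
    using assms(2) by (auto simp: filterlim_at)
qed

text \<open>
  \<open>S h x - x\<close> is split into \<open>n\<close> equal steps and \<open>n \<rightarrow> \<infinity>\<close>; this replaces the integral of
  \<open>\<tau> \<mapsto> S \<tau> y\<close> over \<open>[0, h]\<close>.
\<close>

lemma norm_step_le:
  assumes x: "((\<lambda>t. (S t x - x) /\<^sub>R t) \<longlongrightarrow> y) (at_right 0)" and h: "h \<ge> 0"
  shows "norm (S h x - x) \<le> K * h * norm y"
proof (cases "h = 0")
  case False
  hence h: "h > 0" using h by simp
  have "norm (S h x - x) \<le> K * h * norm ((S (h / Suc n) x - x) /\<^sub>R (h / Suc n))" for n
  proof -
    define \<delta> where "\<delta> = h / Suc n"
    have \<delta>: "\<delta> > 0" "h = Suc n * \<delta>" using h by (simp_all add: \<delta>_def)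
    have "norm (S h x - x) = norm (\<Sum>i<Suc n. S (i * \<delta>) (S \<delta> x - x))"
      unfolding \<delta>(2) using S_telescope[where h = \<delta> and n = "Suc n" and x = x] \<delta>(1)
      by (simp del: sum.lessThan_Suc of_nat_Suc)
    also have "\<dots> \<le> (\<Sum>i<Suc n. K * norm (S \<delta> x - x))"
      using \<delta> by (intro sum_norm_le S_bound) auto
    also have "\<dots> = K * (Suc n * \<delta>) * (norm (S \<delta> x - x) / \<delta>)"
      using \<delta>(1) by simp
    also have "\<dots> = K * h * norm ((S \<delta> x - x) /\<^sub>R \<delta>)"
      using \<delta> by (simp add: divide_inverse mult_ac)
    finally show ?thesis by (simp add: \<delta>_def)
  qed
  moreover have "(\<lambda>n. K * h * norm ((S (h / Suc n) x - x) /\<^sub>R (h / Suc n))) \<longlonglongrightarrow> K * h * norm y"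
    by (intro tendsto_intros tendsto_step[OF x h])
  ultimately show ?thesis by (intro LIMSEQ_le_const) auto
qed (simp add: S_0)

text \<open>Taylor's formula of second order. Each of the \<open>n + 1\<close> steps of length
  \<open>\<delta>\<close> is compared with \<open>\<delta> *\<^sub>R y\<close>: the difference is a
  transported first-order remainder at 0, whose total vanishes as \<open>\<delta>\<close> tends to
  0, plus \<open>\<delta>\<close> times \<open>S (i * \<delta>) y - y\<close>, which
  \<open>norm_step_le\<close> controls.\<close>

lemma norm_step2_le:
  assumes x: "((\<lambda>t. (S t x - x) /\<^sub>R t) \<longlongrightarrow> y) (at_right 0)"
    and y: "((\<lambda>t. (S t y - y) /\<^sub>R t) \<longlongrightarrow> w) (at_right 0)" and h: "h \<ge> 0" and K: "K \<ge> 0"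
  shows "norm (S h x - x - h *\<^sub>R y) \<le> K * h\<^sup>2 * norm w"
proof (cases "h = 0")
  case False
  hence h: "h > 0" using h by simp
  have "norm (S h x - x - h *\<^sub>R y)
      \<le> K * h * norm ((S (h / Suc n) x - x) /\<^sub>R (h / Suc n) - y) + K * h\<^sup>2 * norm w" for n
  proof -
    define \<delta> where "\<delta> = h / Suc n"
    have \<delta>: "\<delta> > 0" "h = Suc n * \<delta>" using h by (simp_all add: \<delta>_def)
    have "norm (S h x - x - h *\<^sub>R y) = norm (\<Sum>i<Suc n. S (i * \<delta>) (S \<delta> x - x) - \<delta> *\<^sub>R y)"
    proof -
      have "(\<Sum>i<Suc n. S (i * \<delta>) (S \<delta> x - x) - \<delta> *\<^sub>R y)
          = (\<Sum>i<Suc n. S (i * \<delta>) (S \<delta> x - x)) - (Suc n * \<delta>) *\<^sub>R y"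
        by (simp only: sum_subtractf sum_constant_scaleR card_lessThan scaleR_scaleR)
      thus ?thesis
        unfolding \<delta>(2) using S_telescope[where h = \<delta> and n = "Suc n" and x = x] \<delta>(1)
        by (simp del: sum.lessThan_Suc of_nat_Suc)
    qed
    also have "\<dots> \<le> (\<Sum>i<Suc n. K * norm (S \<delta> x - x - \<delta> *\<^sub>R y) + K * h * \<delta> * norm w)"
    proof (rule sum_norm_le)
      fix i assume i: "i \<in> {..<Suc n}"
      have eq: "S (i * \<delta>) (S \<delta> x - x) - \<delta> *\<^sub>R y
          = S (i * \<delta>) (S \<delta> x - x - \<delta> *\<^sub>R y) + \<delta> *\<^sub>R (S (i * \<delta>) y - y)"
        using \<delta>(1) by (simp add: linear_diff[OF S_linear] linear_scale[OF S_linear] scaleR_diff_right)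
      have "norm (\<delta> *\<^sub>R (S (i * \<delta>) y - y)) \<le> \<delta> * (K * (i * \<delta>) * norm w)"
        using \<delta> norm_step_le[OF y, of "i * \<delta>"] by simp
      also have "\<dots> \<le> \<delta> * (K * h * norm w)"
        unfolding \<delta>(2) using \<delta>(1) i K by (intro mult_left_mono mult_right_mono) auto
      finally show "norm (S (i * \<delta>) (S \<delta> x - x) - \<delta> *\<^sub>R y)
          \<le> K * norm (S \<delta> x - x - \<delta> *\<^sub>R y) + K * h * \<delta> * norm w"
        unfolding eq using \<delta> S_bound[of "i * \<delta>" "S \<delta> x - x - \<delta> *\<^sub>R y"]
        by (intro norm_triangle_mono) (auto simp: mult_ac)
    qed
    also have "\<dots> = K * h * (norm (S \<delta> x - x - \<delta> *\<^sub>R y) / \<delta>) + K * h\<^sup>2 * norm w"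
    proof -
      have "(\<Sum>i<Suc n. b + K * h * \<delta> * norm w) = (Suc n * \<delta>) * (b / \<delta>) + K * h * (Suc n * \<delta>) * norm w" for b
        using \<delta>(1) by (simp add: distrib_left del: of_nat_Suc)
      thus ?thesis
        by (simp only: \<delta>(2)[symmetric]) (simp add: power2_eq_square)
    qed
    also have "norm (S \<delta> x - x - \<delta> *\<^sub>R y) / \<delta> = norm ((S \<delta> x - x) /\<^sub>R \<delta> - y)"
    proof -
      have "(S \<delta> x - x) /\<^sub>R \<delta> - y = (S \<delta> x - x - \<delta> *\<^sub>R y) /\<^sub>R \<delta>"
        using \<delta> by (simp add: algebra_simps)
      thus ?thesis using \<delta> by (simp add: divide_inverse mult.commute)
    qed
    finally show ?thesis by (simp add: \<delta>_def)
  qed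
  moreover have "(\<lambda>n. K * h * norm ((S (h / Suc n) x - x) /\<^sub>R (h / Suc n) - y) + K * h\<^sup>2 * norm w)
      \<longlonglongrightarrow> K * h * norm (y - y) + K * h\<^sup>2 * norm w"
    by (intro tendsto_intros tendsto_step[OF x h])
  ultimately show ?thesis by (intro LIMSEQ_le_const) auto
qed (simp add: S_0)

end

section \<open>The generator, its resolvents on the imaginary axis and its inverse\<close>

locale bounded_C0_semigroup =
  fixes T :: "real \<Rightarrow> 'a::complex_hilbert \<Rightarrow> 'a" and D A and K :: real
  assumes C0: "C0_semigroup T" and gen: "is_generator T D A"
    and bound: "t \<ge> 0 \<Longrightarrow> norm (T t x) \<le> K * norm x" and K1: "K \<ge> 1"
    and spec: "spectrum D A \<inter> {z. Re z = 0} = {}"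
begin

lemma T_bounded_linear: "t \<ge> 0 \<Longrightarrow> bounded_linear (T t)"
  and T_scaleC: "t \<ge> 0 \<Longrightarrow> T t (c *\<^sub>C x) = c *\<^sub>C T t x"
  and T_0: "T 0 x = x"
  and T_add: "s \<ge> 0 \<Longrightarrow> t \<ge> 0 \<Longrightarrow> T (s + t) x = T s (T t x)"
  using C0 by (auto simp: C0_semigroup_def bounded_clinear_def)

lemma generator_tendsto: "x \<in> D \<Longrightarrow> ((\<lambda>t. (T t x - x) /\<^sub>R t) \<longlongrightarrow> A x) (at_right 0)"
  using gen by (auto simp: is_generator_def)

lemma generatorI:
  assumes "((\<lambda>t. (T t x - x) /\<^sub>R t) \<longlongrightarrow> y) (at_right 0)"
  shows "x \<in> D" "A x = y"
proof -
  show "x \<in> D" using assms gen by (auto simp: is_generator_def)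
  thus "A x = y" using tendsto_unique[OF _ generator_tendsto assms] by simp
qed

lemma generator_add:
  assumes "x \<in> D" "y \<in> D" shows "x + y \<in> D" "A (x + y) = A x + A y"
proof -
  have "((\<lambda>t. (T t x - x) /\<^sub>R t + (T t y - y) /\<^sub>R t) \<longlongrightarrow> A x + A y) (at_right 0)"
    by (intro tendsto_add generator_tendsto assms)
  hence "((\<lambda>t. (T t (x + y) - (x + y)) /\<^sub>R t) \<longlongrightarrow> A x + A y) (at_right 0)"
    by (rule Lim_transform_eventually)
       (auto simp: eventually_at_filter algebra_simps bounded_linear.linear[OF T_bounded_linear, THEN linear_add])
  thus "x + y \<in> D" "A (x + y) = A x + A y" by (rule generatorI)+
qed

lemma generator_scaleC:
  assumes "x \<in> D" shows "c *\<^sub>C x \<in> D" "A (c *\<^sub>C x) = c *\<^sub>C A x"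
proof -
  have "((\<lambda>t. c *\<^sub>C ((T t x - x) /\<^sub>R t)) \<longlongrightarrow> c *\<^sub>C A x) (at_right 0)"
    by (intro tendsto_scaleC tendsto_const generator_tendsto assms)
  hence "((\<lambda>t. (T t (c *\<^sub>C x) - c *\<^sub>C x) /\<^sub>R t) \<longlongrightarrow> c *\<^sub>C A x) (at_right 0)"
    by (rule Lim_transform_eventually)
       (auto simp: eventually_at_filter scaleC_scaleR scaleC_diff_right T_scaleC)
  thus "c *\<^sub>C x \<in> D" "A (c *\<^sub>C x) = c *\<^sub>C A x" by (rule generatorI)+
qed

lemma generator_T:
  assumes "x \<in> D" "s \<ge> 0" shows "T s x \<in> D" "A (T s x) = T s (A x)"
proof -
  interpret Ts: bounded_linear "T s" by (rule T_bounded_linear[OF assms(2)])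
  have "((\<lambda>t. T s ((T t x - x) /\<^sub>R t)) \<longlongrightarrow> T s (A x)) (at_right 0)"
    by (intro Ts.tendsto generator_tendsto assms)
  hence "((\<lambda>t. (T t (T s x) - T s x) /\<^sub>R t) \<longlongrightarrow> T s (A x)) (at_right 0)"
    by (rule Lim_transform_eventually)
       (auto simp: eventually_at_filter Ts.scaleR Ts.diff T_add[symmetric] assms add.commute)
  thus "T s x \<in> D" "A (T s x) = T s (A x)" by (rule generatorI)+
qed

abbreviation Res :: "real \<Rightarrow> 'a \<Rightarrow> 'a" where "Res s \<equiv> resolvent D A (\<i> * complex_of_real s)"

lemma
  shows Res_bij: "bij_betw (\<lambda>x. (\<i> * complex_of_real s) *\<^sub>C x - A x) D UNIV"
    and Res_bounded_linear: "bounded_linear (Res s)"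
    and Res_scaleC: "Res s (c *\<^sub>C x) = c *\<^sub>C Res s x"
proof -
  have "\<i> * complex_of_real s \<notin> spectrum D A" using spec by auto
  thus "bij_betw (\<lambda>x. (\<i> * complex_of_real s) *\<^sub>C x - A x) D UNIV"
    "bounded_linear (Res s)" "Res s (c *\<^sub>C x) = c *\<^sub>C Res s x"
    by (auto simp: spectrum_def bounded_clinear_def)
qed

lemma Res_in: "Res s x \<in> D"
  and Res_right: "A (Res s x) = (\<i> * complex_of_real s) *\<^sub>C Res s x - x"
proof -
  have sur: "(\<lambda>x. (\<i> * complex_of_real s) *\<^sub>C x - A x) ` D = UNIV"
    using Res_bij by (rule bij_betw_imp_surj_on)
  show "Res s x \<in> D"
    unfolding resolvent_def using sur by (intro inv_into_into) simp
  show "A (Res s x) = (\<i> * complex_of_real s) *\<^sub>C Res s x - x"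
    using f_inv_into_f[of x "\<lambda>x. (\<i> * complex_of_real s) *\<^sub>C x - A x" D] sur
    unfolding resolvent_def[symmetric] by (simp add: algebra_simps)
qed

lemma Res_left:
  assumes "x \<in> D" shows "Res s ((\<i> * complex_of_real s) *\<^sub>C x - A x) = x"
  unfolding resolvent_def using bij_betw_imp_inj_on[OF Res_bij] assms
  by (rule inv_into_f_f)

lemma Res_T: "t \<ge> 0 \<Longrightarrow> Res s (T t x) = T t (Res s x)"
  using Res_left[of "T t (Res s x)" s] bounded_linear.linear[OF T_bounded_linear, of t]
  by (simp add: generator_T Res_in Res_right T_scaleC[symmetric] linear_diff)

abbreviation P :: "'a \<Rightarrow> 'a" where "P \<equiv> inv_into D A"

text \<open>Since 0 lies on the imaginary axis, the spectral hypothesis makes the inverse of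
  \<open>A\<close> available as a resolvent; boundedness, complex linearity and commutation of
  \<open>P\<close> are read off from \<open>Res 0\<close>.\<close>

lemma P_eq: "P x = - Res 0 x"
proof -
  have 1: "A (- Res 0 x) = x" "- Res 0 x \<in> D"
    using generator_scaleC[OF Res_in[of 0 x], of "-1"] Res_right[of 0 x]
    by (simp_all add: scaleC_minus_left)
  have inj: "inj_on A D"
    using bij_betw_imp_inj_on[OF Res_bij[of 0]] by (simp add: inj_on_def)
  show ?thesis using inv_into_f_f[OF inj 1(2)] 1(1) by simp
qed

lemma P_in: "P x \<in> D" and A_P: "A (P x) = x"
  using generator_scaleC[OF Res_in[of 0 x], of "-1"] Res_right[of 0 x]
  by (simp_all add: P_eq scaleC_minus_left)

lemma P_bounded_linear: "bounded_linear P"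
  using bounded_linear_minus[OF Res_bounded_linear[of 0]] by (simp add: P_eq[abs_def])

lemma P_scaleC: "P (c *\<^sub>C x) = c *\<^sub>C P x"
  unfolding P_eq Res_scaleC by (simp add: scaleC_minus_right)

lemma P_T: "t \<ge> 0 \<Longrightarrow> P (T t x) = T t (P x)"
  unfolding P_eq Res_T by (simp add: bounded_linear.linear[OF T_bounded_linear] linear_neg)

text \<open>The resolvent identity between \<open>i s\<close> and 0. It is the source of the gain
  \<open>1 / \<bar>s\<bar>\<close> in the bound for \<open>Res s (P w)\<close>.\<close>

lemma Res_P: "(\<i> * complex_of_real s) *\<^sub>C Res s (P x) = Res s x + P x"
proof -
  have "P x = Res s ((\<i> * complex_of_real s) *\<^sub>C P x - x)"
    using Res_left[OF P_in, of s x] by (simp add: A_P)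
  also have "\<dots> = (\<i> * complex_of_real s) *\<^sub>C Res s (P x) - Res s x"
    by (simp only: linear_diff[OF bounded_linear.linear[OF Res_bounded_linear]] Res_scaleC)
  finally show ?thesis by (simp add: algebra_simps)
qed

end

section \<open>Multiplier bounds for the discretised resolvent\<close>

lemma one_minus_exp_ge:
  fixes x :: real assumes "0 \<le> x" "x \<le> 1" shows "1 - exp (- x) \<ge> x / 2"
proof -
  have "exp (- x) \<le> 1 / (1 + x)"
    using exp_ge_add_one_self[of x] assms by (simp add: exp_minus divide_simps)
  moreover have "1 - 1 / (1 + x) \<ge> x / 2"
    using assms mult_left_mono[OF assms(2) assms(1)] by (simp add: field_simps)
  ultimately show ?thesis by linarith
qed

text \<open>Jordan's inequality: on \<open>[0, pi/2]\<close> the concave sine lies above its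
  chord.\<close>

lemma abs_sin_ge:
  fixes x :: real assumes "\<bar>x\<bar> \<le> pi / 2" shows "\<bar>sin x\<bar> \<ge> 2 / pi * \<bar>x\<bar>"
proof -
  have "sin y \<ge> 2 / pi * y" if "0 \<le> y" "y \<le> pi / 2" for y
  proof -
    have "concave_on {0..pi/2} sin"
      unfolding concave_on_def
      by (rule f''_ge0_imp_convex[where f' = "\<lambda>x. - cos x" and f'' = sin])
         (auto intro!: derivative_eq_intros sin_ge_zero)
    moreover have "pi / 2 * (2 / pi * y) = y" by simp
    ultimately show ?thesis
      using concave_onD[of "{0..pi/2}" sin "2 / pi * y" 0 "pi / 2"] that
      by (simp add: field_simps)
  qed
  from this[of "\<bar>x\<bar>"] assms show ?thesis by (cases "x \<ge> 0") auto
qed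

text \<open>Moving from radius \<open>r\<close> to the unit circle costs at most
  \<open>1 - r\<close>, itself a lower bound for the quantity in question, so only a factor 2 is
  lost. On the circle the distance to 1 is
  \<open>2 * \<bar>sin (\<theta> / 2)\<bar>\<close>.\<close>

lemma norm_one_minus_exp_ge:
  assumes "a \<ge> 0" "\<bar>\<theta>\<bar> \<le> pi"
  shows "cmod (1 - exp (- Complex a \<theta>)) \<ge> \<bar>\<theta>\<bar> / pi"
proof -
  define r where "r = exp (- a)"
  have r: "0 < r" "r \<le> 1" using assms by (simp_all add: r_def)
  have e: "exp (- Complex a \<theta>) = of_real r * cis (- \<theta>)"
    by (simp add: r_def exp_eq_polar)
  have 1: "1 - r \<le> cmod (1 - of_real r * cis (- \<theta>))"
    using norm_triangle_ineq2[of 1 "of_real r * cis (- \<theta>)"] r by (simp add: norm_mult)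
  have "cmod (1 - cis (- \<theta>)) \<le> cmod (1 - of_real r * cis (- \<theta>)) + cmod (of_real (r - 1) * cis (- \<theta>))"
    using norm_triangle_ineq[of "1 - of_real r * cis (- \<theta>)" "of_real (r - 1) * cis (- \<theta>)"]
    by (simp add: algebra_simps)
  hence 2: "cmod (1 - cis (- \<theta>)) \<le> 2 * cmod (1 - of_real r * cis (- \<theta>))"
    using 1 r norm_of_real[of "r - 1", where ?'a = complex] by (simp add: norm_mult)
  have "(cmod (1 - cis (- \<theta>)))\<^sup>2 = (2 * \<bar>sin (\<theta> / 2)\<bar>)\<^sup>2"
  proof -
    have "(cmod (1 - cis (- \<theta>)))\<^sup>2 = (1 - cos \<theta>)\<^sup>2 + (sin \<theta>)\<^sup>2" by (simp add: cmod_power2)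
    also have "\<dots> = 2 * (1 - cos \<theta>)" using sin_cos_squared_add[of \<theta>] by (simp add: power2_eq_square algebra_simps)
    also have "cos \<theta> = 1 - 2 * (sin (\<theta> / 2))\<^sup>2" using cos_double_sin[of "\<theta> / 2"] by simp
    finally show ?thesis by (simp add: power_mult_distrib)
  qed
  hence "cmod (1 - cis (- \<theta>)) = 2 * \<bar>sin (\<theta> / 2)\<bar>" by (rule power2_eq_imp_eq) auto
  moreover have "\<bar>sin (\<theta> / 2)\<bar> \<ge> \<bar>\<theta>\<bar> / pi" using abs_sin_ge[of "\<theta> / 2"] assms by simp
  ultimately show ?thesis using 2 e by simp
qed

lemma norm_funpow_le:
  fixes f :: "'a::real_normed_vector \<Rightarrow> 'a"
  assumes "\<And>x. norm (f x) \<le> d * norm x" "d \<ge> 0"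
  shows "norm ((f ^^ n) x) \<le> d ^ n * norm x"
proof (induction n)
  case (Suc n)
  show ?case using assms(1)[of "(f ^^ n) x"] mult_left_mono[OF Suc assms(2)] by (simp add: mult_ac)
qed simp

section \<open>The damped semigroup\<close>

context bounded_C0_semigroup
begin

text \<open>The semigroup whose generator is \<open>A - z\<close>.\<close>

definition S :: "complex \<Rightarrow> real \<Rightarrow> 'a \<Rightarrow> 'a"
  where "S z t x = exp (- z * of_real t) *\<^sub>C T t x"

lemma S_bounded_linear: "t \<ge> 0 \<Longrightarrow> bounded_linear (S z t)"
  unfolding S_def using bounded_linear_compose[OF bounded_linear_scaleC T_bounded_linear] .

lemma S_family: "Re z \<ge> 0 \<Longrightarrow> bounded_additive_family (S z) K"
proof (rule bounded_additive_family.intro)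
  fix t :: real and x assume z: "Re z \<ge> 0" and t: "t \<ge> 0"
  show "linear (S z t)" by (rule bounded_linear.linear[OF S_bounded_linear[OF t]])
  have "norm (S z t x) \<le> 1 * (K * norm x)"
    unfolding S_def norm_scaleC using z t K1 by (intro mult_mono bound) auto
  thus "norm (S z t x) \<le> K * norm x" by simp
next
  fix s t :: real and x assume "s \<ge> 0" "t \<ge> 0"
  thus "S z (s + t) x = S z s (S z t x)"
    by (simp add: S_def T_add T_scaleC scaleC_scaleC distrib_left flip: exp_add)
qed (simp add: S_def T_0)

text \<open>Product rule at 0, using
  \<open>S z t x - x = e^(-zt) (T t x - x) + (e^(-zt) - 1) x\<close>.\<close>

lemma S_tendsto:
  assumes "x \<in> D" shows "((\<lambda>t. (S z t x - x) /\<^sub>R t) \<longlongrightarrow> A x - z *\<^sub>C x) (at_right 0)"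
proof -
  have "((\<lambda>w. exp (- z * w)) has_field_derivative - z) (at 0)"
    by (auto intro!: derivative_eq_intros)
  hence "((\<lambda>w. (exp (- z * w) - 1) / w) \<longlongrightarrow> - z) (at 0)"
    by (simp add: has_field_derivative_iff)
  moreover have "filterlim complex_of_real (at 0) (at_right 0)"
    by (auto simp: filterlim_at eventually_at_filter intro!: tendsto_eq_intros)
  ultimately have "((\<lambda>t. (exp (- z * of_real t) - 1) / complex_of_real t) \<longlongrightarrow> - z) (at_right 0)"
    by (rule filterlim_compose)
  hence "((\<lambda>t. (exp (- z * of_real t) - 1) /\<^sub>R t) \<longlongrightarrow> - z) (at_right 0)"
    by (simp add: scaleR_conv_of_real divide_inverse mult.commute)
  moreover have "((\<lambda>t. exp (- z * of_real t)) \<longlongrightarrow> exp (- z * of_real 0)) (at_right (0::real))"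
    by (intro tendsto_intros)
  ultimately have "((\<lambda>t. exp (- z * of_real t) *\<^sub>C ((T t x - x) /\<^sub>R t)
      + ((exp (- z * of_real t) - 1) /\<^sub>R t) *\<^sub>C x) \<longlongrightarrow> exp (- z * of_real 0) *\<^sub>C A x + (- z) *\<^sub>C x) (at_right 0)"
    by (intro tendsto_add tendsto_scaleC generator_tendsto tendsto_const assms)
  hence "((\<lambda>t. (S z t x - x) /\<^sub>R t) \<longlongrightarrow> exp (- z * of_real 0) *\<^sub>C A x + (- z) *\<^sub>C x) (at_right 0)"
    by (rule Lim_transform_eventually)
       (auto simp: eventually_at_filter S_def scaleC_scaleR scaleC_diff_right scaleC_diff_left
          bounded_bilinear.scaleR_left[OF bounded_bilinear_scaleC] algebra_simps)
  thus ?thesis by (simp add: scaleC_minus_left)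
qed

lemma S_power_decay:
  assumes "Re z > 0" "h > 0" shows "power_decay (S z h) K (exp (- Re z * h))"
proof (rule power_decay.intro)
  show "bounded_linear (S z h)" using assms by (intro S_bounded_linear) simp
next
  fix n x
  interpret bounded_additive_family "S z" K using S_family assms by simp
  have "norm ((S z h ^^ n) x) = norm (S z (n * h) x)" using assms by (simp add: S_funpow)
  also have "\<dots> = exp (- Re z * h) ^ n * norm (T (n * h) x)"
    by (simp add: S_def norm_scaleC mult_ac flip: exp_of_nat_mult)
  also have "\<dots> \<le> exp (- Re z * h) ^ n * (K * norm x)"
    using assms by (intro mult_left_mono bound) auto
  finally show "norm ((S z h ^^ n) x) \<le> K * exp (- Re z * h) ^ n * norm x" by (simp add: mult_ac)
qed (use assms in auto)

end

text \<open>The indices \<open>n\<close> from \<open>m\<close> to \<open>2 m - 1\<close> are the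
  times \<open>n h\<close> in \<open>[t/2, t)\<close>. There the damping \<open>e^(-n h / t)\<close>
  with rate \<open>1/t\<close> is at least \<open>1/e\<close>; per step it equals the
  \<open>r\<close> defined below.\<close>

locale discretised_semigroup = bounded_C0_semigroup +
  fixes t h :: real and m :: nat
  assumes t: "t > 0" and m: "m \<ge> 1" and h: "h = t / (2 * m)"
begin

definition G :: "real \<Rightarrow> 'a \<Rightarrow> 'a" where "G s = S (Complex (1 / t) s) h"

definition Q :: "real \<Rightarrow> 'a \<Rightarrow> 'a" where "Q s x = h *\<^sub>R neumann (G s) x"

definition r :: real where "r = exp (- 1 / (2 * m))"

lemma h0: "h > 0" using t m by (simp add: h)

sublocale G: power_decay "G s" K r for s
proof -
  have "exp (- Re (Complex (1 / t) s) * h) = r" using t by (simp add: r_def h)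
  thus "power_decay (G s) K r"
    using S_power_decay[of "Complex (1 / t) s" h] t h0 by (simp add: G_def)
qed

text \<open>As \<open>1 - r\<close> is at least \<open>1 / (4 m)\<close> and
  \<open>h = t / (2 m)\<close>, the number \<open>m\<close> cancels: refining the step does not
  worsen the bounds on \<open>Q\<close>.\<close>

lemma h_le: "h / (1 - r) \<le> 2 * t"
proof -
  have "1 - r \<ge> 1 / (2 * m) / 2"
    unfolding r_def using one_minus_exp_ge[of "1 / (2 * m)"] m by simp
  hence "h / (1 - r) \<le> h / (1 / (2 * m) / 2)" using h0 m G.r by (intro divide_left_mono mult_pos_pos) auto
  also have "\<dots> = 2 * t" using m by (simp add: h)
  finally show ?thesis .
qed

lemma norm_Q_le: "norm (Q s x) \<le> 2 * K * t * norm x"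
proof -
  have "norm (Q s x) \<le> h * (K / (1 - r) * norm x)"
    using h0 mult_left_mono[OF G.norm_neumann_le[of s x], of h] by (simp add: Q_def)
  also have "\<dots> = (h / (1 - r)) * (K * norm x)" by simp
  also have "\<dots> \<le> 2 * t * (K * norm x)" using K1 by (intro mult_right_mono h_le) auto
  finally show ?thesis by (simp add: mult_ac)
qed

lemma Q_bounded_linear: "bounded_linear (Q s)"
  unfolding Q_def[abs_def]
  by (intro bounded_linear_compose[OF bounded_linear_scaleR_right G.bounded_linear_neumann])

lemma Q_commute:
  assumes "bounded_linear B" "\<And>t x. t \<ge> 0 \<Longrightarrow> B (T t x) = T t (B x)" "\<And>c x. B (c *\<^sub>C x) = c *\<^sub>C B x"
  shows "B (Q s x) = Q s (B x)"
proof -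
  have "B (G s x) = G s (B x)" for x using assms h0 by (simp add: G_def S_def)
  thus ?thesis
    unfolding Q_def
    by (simp add: G.neumann_commute[OF assms(1)] linear_scale[OF bounded_linear.linear[OF assms(1)]])
qed

text \<open>
  With \<open>x = Res s (P w)\<close> both \<open>x\<close> and \<open>A x\<close> lie in the domain, so \<open>x - G s x\<close> agrees with
  \<open>h (z x - A x) = h (P w + x / t)\<close> up to \<open>O(h\<^sup>2)\<close>; then \<open>(I - G s)\<inverse>\<close> is applied to both.
\<close>

lemma low_frequency_error:
  assumes \<rho>: "\<And>x. norm (P x) \<le> \<rho> * norm x" and \<mu>: "\<And>x. norm (Res s x) \<le> \<mu> * norm x"
    and "\<mu> \<ge> 0"
  shows "norm (Q s (P w) - (Res s (P w) - (1 / t) *\<^sub>R Q s (Res s (P w))))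
    \<le> 2 * K\<^sup>2 * t * h * (1 + (2 / t + \<bar>s\<bar>) * \<rho> + \<mu> * \<rho> / t\<^sup>2) * norm w"
proof -
  define z where "z = Complex (1 / t) s"
  define x where "x = Res s (P w)"
  define y1 where "y1 = A x - z *\<^sub>C x"
  define y2 where "y2 = A y1 - z *\<^sub>C y1"
  have z: "z = complex_of_real (1 / t) + \<i> * of_real s" by (simp add: z_def complex_eq_iff)
  interpret fam: bounded_additive_family "S z" K using S_family t by (simp add: z_def)
  interpret N: bounded_linear "neumann (G s)" by (rule G.bounded_linear_neumann)
  have x: "x \<in> D" by (simp add: x_def Res_in)
  \<comment> \<open>Here \<open>A x = i s x - P w\<close> and \<open>z - i s = 1/t\<close>, so the
    terms with \<open>i s\<close> cancel and only elements of \<open>D\<close> remain.\<close>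
  have y1: "y1 = (-1) *\<^sub>C P w + (- complex_of_real (1 / t)) *\<^sub>C x"
    unfolding y1_def x_def Res_right z by (simp add: scaleC_add_left scaleC_minus_left)
  have y1D: "y1 \<in> D" unfolding y1 by (intro generator_add generator_scaleC P_in x)
  have "A y1 = (-1) *\<^sub>C w + (- complex_of_real (1 / t)) *\<^sub>C A x"
    unfolding y1 by (simp add: generator_add generator_scaleC P_in x A_P)
  also have "A x = y1 + z *\<^sub>C x" by (simp add: y1_def)
  finally have Ay1: "A y1 = (-1) *\<^sub>C w + (- complex_of_real (1 / t)) *\<^sub>C (y1 + z *\<^sub>C x)" .
  have y2: "y2 = - w + (complex_of_real (1 / t) + z) *\<^sub>C P w + complex_of_real (1 / t ^ 2) *\<^sub>C x"
  proof -
    define c where "c = complex_of_real (1 / t)"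
    have c2: "complex_of_real (1 / t ^ 2) = c * c" by (simp add: c_def power2_eq_square)
    have "y2 = (-1) *\<^sub>C w + (- c) *\<^sub>C (y1 + z *\<^sub>C x) - z *\<^sub>C y1"
      unfolding y2_def Ay1 c_def ..
    also have "\<dots> = - w + (c + z) *\<^sub>C P w + (c * c) *\<^sub>C x"
      unfolding y1 c_def[symmetric]
      by (simp add: scaleC_add_left scaleC_add_right scaleC_minus_left scaleC_minus_right
          scaleC_scaleC scaleC_diff_right mult.commute)
    finally show ?thesis unfolding c2 c_def[symmetric] .
  qed
  have nP: "norm (P w) \<le> \<rho> * norm w" by (rule \<rho>)
  have nx: "norm x \<le> \<mu> * (\<rho> * norm w)"
    using \<mu>[of "P w"] mult_left_mono[OF nP \<open>\<mu> \<ge> 0\<close>] by (simp add: x_def)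
  have "cmod (complex_of_real (1 / t) + z) \<le> 2 / t + \<bar>s\<bar>"
    using norm_triangle_ineq[of "complex_of_real (2 / t)" "\<i> * of_real s"] t
    by (simp add: z norm_mult norm_divide)
  hence "norm ((complex_of_real (1 / t) + z) *\<^sub>C P w) \<le> (2 / t + \<bar>s\<bar>) * (\<rho> * norm w)"
    unfolding norm_scaleC using nP t by (intro mult_mono) auto
  moreover have "norm (complex_of_real (1 / t ^ 2) *\<^sub>C x) \<le> 1 / t ^ 2 * (\<mu> * (\<rho> * norm w))"
    unfolding norm_scaleC using nx t by (simp add: norm_divide norm_power divide_right_mono)
  ultimately have ny2: "norm y2 \<le> norm w + (2 / t + \<bar>s\<bar>) * (\<rho> * norm w) + 1 / t ^ 2 * (\<mu> * (\<rho> * norm w))"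
    unfolding y2 by (intro norm_triangle_mono) auto
  define e where "e = G s x - x - h *\<^sub>R y1"
  have "norm e \<le> K * h\<^sup>2 * norm y2"
    unfolding e_def G_def z_def[symmetric]
    by (rule fam.norm_step2_le) (use x y1D h0 K1 in \<open>auto simp: y1_def y2_def intro!: S_tendsto\<close>)
  also have "\<dots> \<le> K * h\<^sup>2 * ((1 + (2 / t + \<bar>s\<bar>) * \<rho> + \<mu> * \<rho> / t\<^sup>2) * norm w)"
    using ny2 K1 by (intro mult_left_mono) (auto simp: algebra_simps)
  finally have ne: "norm e \<le> K * h\<^sup>2 * ((1 + (2 / t + \<bar>s\<bar>) * \<rho> + \<mu> * \<rho> / t\<^sup>2) * norm w)" .
  have "x = neumann (G s) (x - G s x)" by (simp add: G.neumann_diff)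
  also have "x - G s x = h *\<^sub>R P w + (h / t) *\<^sub>R x - e"
  proof -
    have "y1 = - P w - (1 / t) *\<^sub>R x"
      unfolding y1 scaleC_minus_left scaleC_of_real by simp
    thus ?thesis by (simp add: e_def scaleR_diff_right)
  qed
  finally have eq: "Q s (P w) - (x - (1 / t) *\<^sub>R Q s x) = neumann (G s) e"
    by (simp add: N.add N.diff N.scaleR Q_def algebra_simps)
  have "norm (neumann (G s) e) \<le> K / (1 - r) * norm e" by (rule G.norm_neumann_le)
  also have "\<dots> \<le> K / (1 - r) * (K * h\<^sup>2 * ((1 + (2 / t + \<bar>s\<bar>) * \<rho> + \<mu> * \<rho> / t\<^sup>2) * norm w))"
    using K1 G.r by (intro mult_left_mono ne) auto
  also have "\<dots> = (h / (1 - r)) * (K\<^sup>2 * h * ((1 + (2 / t + \<bar>s\<bar>) * \<rho> + \<mu> * \<rho> / t\<^sup>2) * norm w))"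
    by (simp add: power2_eq_square)
  also have "\<dots> \<le> (2 * t) * (K\<^sup>2 * h * ((1 + (2 / t + \<bar>s\<bar>) * \<rho> + \<mu> * \<rho> / t\<^sup>2) * norm w))"
  \<comment> \<open>As \<open>\<rho>\<close> carries no sign condition, the sign of the factor is
    read off from \<open>ne\<close>.\<close>
  proof (rule mult_right_mono[OF h_le])
    have "K * h\<^sup>2 * ((1 + (2 / t + \<bar>s\<bar>) * \<rho> + \<mu> * \<rho> / t\<^sup>2) * norm w) \<ge> 0"
      using ne norm_ge_zero order_trans by blast
    moreover have "K * h\<^sup>2 > 0" using K1 h0 by simp
    ultimately have "(1 + (2 / t + \<bar>s\<bar>) * \<rho> + \<mu> * \<rho> / t\<^sup>2) * norm w \<ge> 0"
      by (metis zero_le_mult_iff not_less order.strict_implies_order)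
    thus "0 \<le> K\<^sup>2 * h * ((1 + (2 / t + \<bar>s\<bar>) * \<rho> + \<mu> * \<rho> / t\<^sup>2) * norm w)"
      using K1 h0 by simp
  qed
  finally show ?thesis using eq by (simp add: x_def mult_ac)
qed

text \<open>With \<open>G s = \<zeta> T(h)\<close>, the vector \<open>(1 - \<zeta>) P w\<close> is
  \<open>(I - G s) P w\<close> plus \<open>\<zeta> (T(h) - I) P w\<close>. The Neumann series
  inverts the first term; on the second its norm \<open>O(t / h)\<close> is compensated by
  \<open>T(h) P - P = O(h)\<close>. Dividing by \<open>1 - \<zeta>\<close>, of modulus at least
  \<open>\<bar>s\<bar> h / pi\<close> in this band, gains \<open>1 / \<bar>s\<bar>\<close>.\<close>

lemma high_frequency_bound:
  assumes \<rho>: "\<And>x. norm (P x) \<le> \<rho> * norm x" and s: "\<bar>s\<bar> * h \<le> pi" "s \<noteq> 0"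
  shows "norm (Q s (P w)) \<le> pi * (\<rho> + 2 * K\<^sup>2 * t) / \<bar>s\<bar> * norm w"
proof -
  interpret N: bounded_linear "neumann (G s)" by (rule G.bounded_linear_neumann)
  define \<zeta> where "\<zeta> = exp (- Complex (1 / t) s * of_real h)"
  have "\<zeta> = exp (- Complex (h / t) (s * h))"
    by (simp add: \<zeta>_def) (simp add: complex_eq_iff Re_exp Im_exp)
  hence lower: "cmod (1 - \<zeta>) \<ge> \<bar>s\<bar> * h / pi"
    using norm_one_minus_exp_ge[of "h / t" "s * h"] t h0 s by (simp add: abs_mult)
  have \<zeta>1: "cmod \<zeta> \<le> 1" using t h0 by (simp add: \<zeta>_def)
  have Nc: "neumann (G s) (c *\<^sub>C x) = c *\<^sub>C neumann (G s) x" for c x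
    using h0 by (intro G.neumann_commute[symmetric] bounded_linear_scaleC)
      (simp add: G_def S_def T_scaleC scaleC_scaleC mult.commute)
  interpret T0: bounded_additive_family T K
    using S_family[of 0] by (simp add: S_def[abs_def])
  have "(1 - \<zeta>) *\<^sub>C neumann (G s) (P w) = neumann (G s) ((P w - G s (P w)) + \<zeta> *\<^sub>C (T h (P w) - P w))"
    by (simp add: Nc[symmetric] scaleC_diff_left) (simp add: G_def S_def \<zeta>_def scaleC_diff_right)
  also have "\<dots> = P w + \<zeta> *\<^sub>C neumann (G s) (T h (P w) - P w)"
    by (simp add: N.add G.neumann_diff Nc)
  also have "norm \<dots> \<le> \<rho> * norm w + 1 * (K / (1 - r) * (K * h * norm w))"
  proof (rule norm_triangle_mono[OF \<rho>])
    have "norm (neumann (G s) (T h (P w) - P w)) \<le> K / (1 - r) * norm (T h (P w) - P w)"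
      by (rule G.norm_neumann_le)
    also have "\<dots> \<le> K / (1 - r) * (K * h * norm w)"
      using K1 G.r h0 T0.norm_step_le[OF generator_tendsto[OF P_in[of w]], of h]
      by (intro mult_left_mono) (auto simp: A_P)
    finally show "norm (\<zeta> *\<^sub>C neumann (G s) (T h (P w) - P w)) \<le> 1 * (K / (1 - r) * (K * h * norm w))"
      unfolding norm_scaleC using \<zeta>1 by (intro mult_mono) auto
  qed
  also have "\<dots> = \<rho> * norm w + h / (1 - r) * (K\<^sup>2 * norm w)" by (simp add: power2_eq_square)
  also have "\<dots> \<le> \<rho> * norm w + 2 * t * (K\<^sup>2 * norm w)"
    by (intro add_left_mono mult_right_mono h_le) auto
  finally have "cmod (1 - \<zeta>) * norm (neumann (G s) (P w)) \<le> (\<rho> + 2 * K\<^sup>2 * t) * norm w"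
    by (simp add: norm_scaleC algebra_simps)
  moreover have "\<bar>s\<bar> * h / pi * norm (neumann (G s) (P w)) \<le> cmod (1 - \<zeta>) * norm (neumann (G s) (P w))"
    by (intro mult_right_mono lower) auto
  ultimately have "\<bar>s\<bar> * h / pi * norm (neumann (G s) (P w)) \<le> (\<rho> + 2 * K\<^sup>2 * t) * norm w" by linarith
  moreover have "norm (Q s (P w)) = h * norm (neumann (G s) (P w))" using h0 by (simp add: Q_def)
  ultimately show ?thesis using s(2) by (simp add: field_simps)
qed

end

section \<open>From multiplier bounds to decay\<close>

text \<open>With \<open>l = R / s\<close>, positive increase gives
  \<open>c * l powr \<alpha> * M s \<le> M R \<le> t\<close>. In the \<open>p\<close>-th power the
  factor \<open>l powr (p * \<alpha>)\<close> dominates \<open>l\<close>, which is why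
  \<open>p * \<alpha> \<ge> 1\<close> is imposed.\<close>

lemma positive_increase_power:
  fixes M :: "real \<Rightarrow> real"
  assumes pos: "\<And>s. s \<ge> 0 \<Longrightarrow> M s > 0" and c: "c > 0" and s0: "s0 > 0" and p: "p * \<alpha> \<ge> 1"
    and inc: "\<And>l s. l \<ge> 1 \<Longrightarrow> s \<ge> s0 \<Longrightarrow> M (l * s) / M s \<ge> c * l powr \<alpha>"
    and s: "s0 \<le> s" "s \<le> R" and t: "M R \<le> t"
  shows "M s ^ p * R \<le> s * (t / c) ^ p"
proof -
  define l where "l = R / s"
  have l: "l \<ge> 1" "R = l * s" using s s0 by (simp_all add: l_def)
  have Ms: "M s > 0" using pos s s0 by simp
  have "l powr 1 \<le> l powr (p * \<alpha>)" using l(1) p by (intro powr_mono) auto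
  also have "\<dots> = (l powr \<alpha>) ^ p" using l(1) by (simp add: powr_powr mult.commute flip: powr_realpow)
  finally have lp: "l \<le> (l powr \<alpha>) ^ p" using l(1) by simp
  have "c * l powr \<alpha> * M s \<le> M R" using inc[OF l(1) s(1)] Ms by (simp add: l(2) field_simps)
  hence "l powr \<alpha> * M s \<le> t / c" using t c by (simp add: field_simps)
  hence "(l powr \<alpha> * M s) ^ p \<le> (t / c) ^ p" using Ms by (intro power_mono) auto
  moreover have "l * M s ^ p \<le> (l powr \<alpha> * M s) ^ p"
    unfolding power_mult_distrib using lp Ms by (intro mult_right_mono) auto
  ultimately have "l * M s ^ p \<le> (t / c) ^ p" by linarith
  hence "s * (l * M s ^ p) \<le> s * (t / c) ^ p" using s s0 by (intro mult_left_mono) auto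
  thus ?thesis by (simp add: l(2) mult_ac)
qed

section \<open>Powers of the discretised resolvent and the passage to the time domain\<close>

context discretised_semigroup
begin

lemma Q_funpow: "(Q s ^^ n) x = h ^ n *\<^sub>R (neumann (G s) ^^ n) x"
proof -
  interpret N: bounded_linear "neumann (G s)" by (rule G.bounded_linear_neumann)
  have "(Q s ^^ n) x = ((\<lambda>y. h *\<^sub>R y) ^^ n) ((neumann (G s) ^^ n) x)"
    unfolding Q_def[abs_def] by (rule funpow_compose_commute) (simp add: N.scaleR)
  moreover have "((\<lambda>y. h *\<^sub>R y) ^^ n) y = h ^ n *\<^sub>R y" for y :: 'a by (induction n) simp_all
  ultimately show ?thesis by simp
qed

text \<open>By the resolvent identity, \<open>R(z,A)\<close> equals
  \<open>(I - R(z,A) / t) R(is,A)\<close> for \<open>z = 1/t + i s\<close>. Its discretised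
  right-hand side is \<open>B\<close>, which approximates \<open>Q s\<close> on the range of
  \<open>P\<close> by \<open>low_frequency_error\<close>. The factor \<open>W\<close> has norm at
  most \<open>1 + 2 K\<close>, so powers of \<open>Q s\<close> are compared with powers of
  \<open>Res s\<close>.\<close>

lemma low_frequency_bound:
  assumes \<rho>: "\<And>x. norm (P x) \<le> \<rho> * norm x" and \<mu>: "\<And>x. norm (Res s x) \<le> \<mu> * norm x"
    and "\<mu> \<ge> 0" and d: "d \<ge> 1" "d \<ge> 2 * K * t" "d \<ge> (1 + 2 * K) * \<mu>"
  shows "norm ((Q s ^^ n) (P w)) \<le> (1 + 2 * K) ^ n * norm ((Res s ^^ n) (P w))
    + n * d ^ n * (2 * K\<^sup>2 * t * h * (1 + (2 / t + \<bar>s\<bar>) * \<rho> + \<mu> * \<rho> / t\<^sup>2) * norm w)"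
proof -
  define W where "W x = x - (1 / t) *\<^sub>R Q s x" for x
  define B where "B x = W (Res s x)" for x
  interpret Q: bounded_linear "Q s" by (rule Q_bounded_linear)
  interpret R: bounded_linear "Res s" by (rule Res_bounded_linear)
  have RQ: "Res s (Q s x) = Q s (Res s x)" for x
    by (rule Q_commute) (auto simp: Res_T Res_scaleC Res_bounded_linear)
  have WR: "W (Res s x) = Res s (W x)" for x by (simp add: W_def RQ R.diff R.scaleR)
  have nW: "norm (W x) \<le> (1 + 2 * K) * norm x" for x
  proof -
    have "norm (W x) \<le> norm x + norm ((1 / t) *\<^sub>R Q s x)" unfolding W_def by (rule norm_triangle_ineq4)
    also have "norm ((1 / t) *\<^sub>R Q s x) \<le> 1 / t * (2 * K * t * norm x)"
      using t mult_left_mono[OF norm_Q_le[of s x], of "1 / t"] by simp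
    also have "\<dots> = 2 * K * norm x" using t by simp
    finally show ?thesis by (simp add: algebra_simps)
  qed
  have nB: "norm (B x) \<le> d * norm x" for x
  proof -
    have "norm (B x) \<le> (1 + 2 * K) * (\<mu> * norm x)"
      unfolding B_def using nW[of "Res s x"] mult_left_mono[OF \<mu>[of x], of "1 + 2 * K"] K1 by linarith
    also have "\<dots> \<le> d * norm x" using mult_right_mono[OF d(3), of "norm x"] by simp
    finally show ?thesis .
  qed
  have "linear B"
    by (rule linearI) (simp_all add: B_def W_def R.add R.scaleR Q.add Q.scaleR algebra_simps)
  moreover have "Q s (B x) = B (Q s x)" for x by (simp add: B_def W_def RQ Q.diff Q.scaleR)
  moreover have "norm (Q s x) \<le> d * norm x" for x
    using norm_Q_le[of s x] mult_right_mono[OF d(2), of "norm x"] by simp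
  ultimately have 1: "norm ((Q s ^^ n) (P w) - (B ^^ n) (P w))
      \<le> n * d ^ n * (2 * K\<^sup>2 * t * h * (1 + (2 / t + \<bar>s\<bar>) * \<rho> + \<mu> * \<rho> / t\<^sup>2) * norm w)"
    using low_frequency_error[OF \<rho> \<mu> \<open>\<mu> \<ge> 0\<close>, of w] nB d(1) Q.linear_axioms
    by (intro norm_funpow_diff_le) (auto simp: B_def W_def)
  have "(B ^^ n) (P w) = (W ^^ n) ((Res s ^^ n) (P w))"
    unfolding B_def[abs_def] by (rule funpow_compose_commute) (rule WR)
  hence "norm ((B ^^ n) (P w)) \<le> (1 + 2 * K) ^ n * norm ((Res s ^^ n) (P w))"
    using norm_funpow_le[OF nW] K1 by simp
  thus ?thesis using 1 norm_triangle_ineq2[of "(Q s ^^ n) (P w)" "(B ^^ n) (P w)"] by linarith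
qed

text \<open>The multiplier bound turns into an estimate of square sums. On the left at least
  \<open>m\<close> terms are as large as \<open>L\<close>, a multiple of
  \<open>t ^ p * norm (T t (P y))\<close>; on the right the square sum of \<open>g\<close> is
  \<open>O(m)\<close>. Hence \<open>m\<close> cancels.\<close>

lemma norm_T_le_multiplier_bound:
  assumes p: "p \<ge> 1" and "B \<ge> 0"
    and B: "\<And>s w. \<bar>s\<bar> * h \<le> pi \<Longrightarrow> norm ((Q s ^^ p) (P w)) \<le> B * norm w"
  shows "norm (T t (P y)) \<le> 2 * exp 1 * K\<^sup>2 * (2 * real p / t) ^ p * B * norm y"
proof -
  \<comment> \<open>The transform of \<open>f\<close> at \<open>\<zeta> = e\<^bsup>-ish\<^esup>\<close> is \<open>(Q s)\<^sup>p P\<close> applied to that of \<open>g\<close>.\<close>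
  define f where "f n = h ^ p *\<^sub>R (real ((n + p) choose p) *\<^sub>R (G 0 ^^ n) (P y))" for n
  define g where "g n = (G 0 ^^ n) y" for n
  have sg: "summable (\<lambda>n. norm (g n))"
    unfolding g_def using G.summable_norm_binomial[of 0 0 y] by simp
  have sf: "summable (\<lambda>n. norm (f n))"
    unfolding f_def norm_scaleR[of "h ^ p"] by (intro summable_mult G.summable_norm_binomial)
  have transform: "norm (\<Sum>n. \<zeta> ^ n *\<^sub>C f n) \<le> B * norm (\<Sum>n. \<zeta> ^ n *\<^sub>C g n)" if \<zeta>: "cmod \<zeta> = 1" for \<zeta>
  proof -
    \<comment> \<open>Every point of the unit circle is \<open>e^(-ish)\<close> with
      \<open>\<bar>s\<bar> * h \<le> pi\<close>, so the multiplier bound is needed only in this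
      band.\<close>
    define s where "s = - Arg \<zeta> / h"
    have s: "\<bar>s\<bar> * h \<le> pi" using h0 Arg_bounded[of \<zeta>] by (simp add: s_def abs_le_iff)
    have "\<zeta> = exp (\<i> * Arg \<zeta>)" using Arg_eq[of \<zeta>] \<zeta> by fastforce
    also have "\<i> * Arg \<zeta> = - (\<i> * of_real s * of_real h)" using h0 by (simp add: s_def)
    finally have \<zeta>_eq: "\<zeta> = exp (- (\<i> * of_real s * of_real h))" .
    have G: "G s x = \<zeta> *\<^sub>C G 0 x" for x
    proof -
      have "- Complex (1 / t) s * of_real h = - (\<i> * of_real s * of_real h) + (- Complex (1 / t) 0 * of_real h)"
        by (simp add: Complex_eq algebra_simps)
      thus ?thesis unfolding G_def S_def \<zeta>_eq scaleC_scaleC by (simp only: exp_add)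
    qed
    have G0: "G 0 (c *\<^sub>C x) = c *\<^sub>C G 0 x" for c x
      using h0 by (simp add: G_def S_def T_scaleC scaleC_scaleC mult.commute)
    have Gn: "(G s ^^ n) x = \<zeta> ^ n *\<^sub>C (G 0 ^^ n) x" for n x
      by (induction n) (simp_all add: G G0 scaleC_scaleC)
    have "(\<lambda>n. \<zeta> ^ n *\<^sub>C f n) sums (h ^ p *\<^sub>R (neumann (G s) ^^ Suc p) (P y))"
      using sums_scaleR_right[OF G.neumann_power_sums[of p s "P y"], of "h ^ p"]
      by (simp add: f_def Gn scaleC_scaleR)
    \<comment> \<open>Of the \<open>p + 1\<close> Neumann factors one moves past \<open>P\<close>
      onto \<open>y\<close>, where it is the transform of \<open>g\<close>; the others combine with
      \<open>h ^ p\<close> to \<open>Q s ^^ p\<close>.\<close>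
    also have "(neumann (G s) ^^ Suc p) (P y) = (neumann (G s) ^^ p) (P (neumann (G s) y))"
    proof -
      have "P (neumann (G s) y) = neumann (G s) (P y)"
        using h0 by (intro G.neumann_commute P_bounded_linear) (simp add: G_def S_def P_T P_scaleC)
      thus ?thesis by (simp add: funpow_swap1)
    qed
    also have "h ^ p *\<^sub>R \<dots> = (Q s ^^ p) (P (neumann (G s) y))" by (simp add: Q_funpow)
    finally have "(\<Sum>n. \<zeta> ^ n *\<^sub>C f n) = (Q s ^^ p) (P (neumann (G s) y))" by (rule sums_unique[symmetric])
    moreover have "neumann (G s) y = (\<Sum>n. \<zeta> ^ n *\<^sub>C g n)" by (simp add: neumann_def g_def Gn)
    ultimately show ?thesis using B[OF s] by simp
  qed
  have r2: "r ^ 2 < 1" "0 \<le> r ^ 2" using G.r by (simp_all add: power_less_one_iff)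
  have "1 - r ^ 2 \<ge> 1 / (2 * m)"
    unfolding r_def using one_minus_exp_ge[of "1 / m"] m by (simp flip: exp_of_nat_mult)
  hence r2': "1 / (1 - r ^ 2) \<le> 2 * m"
    using r2 m by (simp add: field_simps)
  have gsum: "(\<Sum>n<N. (norm (g n))\<^sup>2) \<le> (K * norm y)\<^sup>2 * (2 * m)" for N
  proof -
    have "(\<Sum>n<N. (norm (g n))\<^sup>2) \<le> (\<Sum>n<N. (K * norm y)\<^sup>2 * (r ^ 2) ^ n)"
    proof (rule sum_mono)
      fix n
      have "(norm (g n))\<^sup>2 \<le> (K * r ^ n * norm y)\<^sup>2"
        unfolding g_def by (intro power_mono G.decay) auto
      thus "(norm (g n))\<^sup>2 \<le> (K * norm y)\<^sup>2 * (r ^ 2) ^ n"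
        by (simp add: power_mult_distrib mult_ac flip: power_mult)
    qed
    also have "\<dots> = (K * norm y)\<^sup>2 * (\<Sum>n<N. (r ^ 2) ^ n)" by (simp add: sum_distrib_left)
    also have "(\<Sum>n<N. (r ^ 2) ^ n) \<le> (\<Sum>n. (r ^ 2) ^ n)"
      using r2 by (intro sum_le_suminf summable_geometric) auto
    also have "(\<Sum>n. (r ^ 2) ^ n) = 1 / (1 - r ^ 2)" using r2 by (intro suminf_geometric) auto
    also note r2'
    finally show ?thesis by (simp add: mult_left_mono)
  qed
  \<comment> \<open>The power comes from \<open>n h \<ge> t/2\<close> and the bound of the binomial
    coefficient by \<open>((n + p) / p) ^ p\<close>, the factor \<open>exp (-1)\<close> from the
    damping up to time \<open>t\<close>, and \<open>1 / K\<close> from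
    \<open>T(t) = T(t - n h) T(n h)\<close>.\<close>
  define L where "L = (t / (2 * real p)) ^ p * (exp (-1) * (norm (T t (P y)) / K))"
  have L0: "L \<ge> 0" using t K1 by (simp add: L_def)
  have lower: "L \<le> norm (f n)" if n: "n \<in> {m..<2 * m}" for n
  proof -
    interpret fam: bounded_additive_family "S (Complex (1 / t) 0)" K using S_family t by simp
    have nh: "0 \<le> n * h" "n * h \<le> t" "t / 2 \<le> n * h"
      using n h0 m t by (auto simp: h field_simps)
    have "(G 0 ^^ n) (P y) = S (Complex (1 / t) 0) (n * h) (P y)"
      unfolding G_def using h0 by (simp add: fam.S_funpow)
    hence "norm ((G 0 ^^ n) (P y)) = exp (- (n * h / t)) * norm (T (n * h) (P y))"
      using t by (simp add: S_def norm_scaleC)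
    also have "\<dots> \<ge> exp (-1) * (norm (T t (P y)) / K)"
    proof (intro mult_mono)
      have "T t (P y) = T (t - n * h) (T (n * h) (P y))"
        using nh T_add[of "t - n * h" "n * h" "P y"] by simp
      thus "norm (T t (P y)) / K \<le> norm (T (n * h) (P y))"
        using bound[of "t - n * h" "T (n * h) (P y)"] nh K1 by (simp add: field_simps)
    qed (use nh t K1 in auto)
    finally have 1: "exp (-1) * (norm (T t (P y)) / K) \<le> norm ((G 0 ^^ n) (P y))" .
    have "(t / (2 * real p)) ^ p \<le> (h * (real (n + p) / p)) ^ p"
    proof (rule power_mono)
      have "t / (2 * real p) \<le> (n * h) / p" using nh p by (simp add: field_simps)
      also have "\<dots> \<le> h * (real (n + p) / p)" using p h0 by (simp add: field_simps)
      finally show "t / (2 * real p) \<le> h * (real (n + p) / p)" .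
    qed (use t in auto)
    also have "\<dots> = h ^ p * (real (n + p) / p) ^ p" by (rule power_mult_distrib)
    also have "\<dots> \<le> h ^ p * real ((n + p) choose p)"
      using h0 binomial_ge_n_over_k_pow_k[of p "n + p", where ?'a = real] by (intro mult_left_mono) auto
    finally have "(t / (2 * real p)) ^ p \<le> h ^ p * real ((n + p) choose p)" .
    hence "L \<le> (h ^ p * real ((n + p) choose p)) * norm ((G 0 ^^ n) (P y))"
      unfolding L_def using 1 h0 K1 by (intro mult_mono) auto
    thus ?thesis using h0 by (simp add: f_def)
  qed
  have "m * L\<^sup>2 = (\<Sum>n\<in>{m..<2 * m}. L\<^sup>2)" by simp
  also have "\<dots> \<le> (\<Sum>n\<in>{m..<2 * m}. (norm (f n))\<^sup>2)"
    by (intro sum_mono power_mono lower L0)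
  also have "\<dots> \<le> (\<Sum>n<2 * m. (norm (f n))\<^sup>2)" by (intro sum_mono2) auto
  also have "\<dots> \<le> B\<^sup>2 * ((K * norm y)\<^sup>2 * (2 * m))"
    by (rule l2_bound_of_transform_bound[OF sf sg \<open>B \<ge> 0\<close> transform gsum])
  finally have "m * L\<^sup>2 \<le> m * (2 * (B * (K * norm y))\<^sup>2)"
    by (simp add: power_mult_distrib mult_ac)
  hence "L\<^sup>2 \<le> 2 * (B * (K * norm y))\<^sup>2" using m by simp
  also have "\<dots> \<le> (2 * (B * (K * norm y)))\<^sup>2"
    unfolding power_mult_distrib[of 2] by (intro mult_right_mono) auto
  finally have L: "L \<le> 2 * (B * (K * norm y))"
    by (rule power2_le_imp_le) (use \<open>B \<ge> 0\<close> K1 in simp)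
  have inv: "(2 * real p / t) ^ p * (t / (2 * real p)) ^ p = 1"
    using t p by (simp flip: power_mult_distrib)
  have "norm (T t (P y)) = (exp 1 * K * (2 * real p / t) ^ p) * L"
  proof -
    have "(exp 1 * K * (2 * real p / t) ^ p) * L
        = ((2 * real p / t) ^ p * (t / (2 * real p)) ^ p) * (exp 1 * exp (-1)) * (K * (norm (T t (P y)) / K))"
      unfolding L_def by (simp only: mult_ac)
    also have "\<dots> = norm (T t (P y))" unfolding inv using K1 by (simp flip: exp_add)
    finally show ?thesis ..
  qed
  also have "\<dots> \<le> (exp 1 * K * (2 * real p / t) ^ p) * (2 * (B * (K * norm y)))"
    using K1 t by (intro mult_left_mono L) auto
  finally show ?thesis by (simp add: power2_eq_square mult_ac)
qed

end

context bounded_C0_semigroup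
begin

text \<open>The multiplier is bounded by a constant times \<open>t ^ p / R\<close>, separately for
  \<open>\<bar>s\<bar> \<le> R\<close> and beyond, and the powers of \<open>t\<close> cancel in
  \<open>norm_T_le_multiplier_bound\<close>. The step size may depend on \<open>t\<close> and
  \<open>R\<close>, as no constant in the result involves \<open>m\<close>.\<close>

lemma norm_T_P_le:
  fixes M :: "real \<Rightarrow> real" and p :: nat and \<alpha> :: real
  assumes Res_le: "\<And>s x. norm (Res s x) \<le> M \<bar>s\<bar> * norm x"
    and pos: "\<And>s. s \<ge> 0 \<Longrightarrow> M s > 0" and mono: "mono_on {0..} M"
    and c: "c > 0" and s0: "s0 > 0" and p\<alpha>: "p * \<alpha> \<ge> 1" and p1: "p \<ge> 1"
    and inc: "\<And>l s. l \<ge> 1 \<Longrightarrow> s \<ge> s0 \<Longrightarrow> M (l * s) / M s \<ge> c * l powr \<alpha>"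
    and R: "s0 \<le> R" "M R \<le> t" and t1: "t \<ge> 1"
  shows "norm (T t (P y)) \<le> 2 * exp 1 * K\<^sup>2 * (2 * real p) ^ p
    * ((1 + 2 * K) ^ p * ((2 + M 0 * s0) / c ^ p) + 1 + (2 * K) ^ (p - 1) * (pi * (M 0 + 2 * K\<^sup>2)))
    / R * norm y"
proof -
  have R0: "R > 0" using R s0 by simp
  have t0: "t > 0" using t1 by simp
  have Mmono: "M a \<le> M b" if "0 \<le> a" "a \<le> b" for a b using mono that by (auto simp: mono_on_def)
  have M0: "M s \<ge> 0" if "s \<ge> 0" for s using pos[OF that] by simp
  have P_le: "norm (P x) \<le> M 0 * norm x" for x using Res_le[of 0 x] by (simp add: P_eq)
  obtain q where q: "p = Suc q" using p1 by (cases p) auto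
  have quotient_le: "a / b \<le> x / R" if "a * R \<le> b * x" "b > 0" for a b x
    using that R0 by (simp add: field_simps)
  \<comment> \<open>The maximum of the constants for \<open>s0 \<le> \<bar>s\<bar> \<le> R\<close>
    and for \<open>\<bar>s\<bar> < s0\<close> is replaced by their sum.\<close>
  define C3 where "C3 = (2 + M 0 * s0) / c ^ p"
  have C3: "2 / c ^ p \<le> C3" "M 0 * s0 / c ^ p \<le> C3" "C3 \<ge> 0"
    using c s0 M0[of 0] by (simp_all add: C3_def divide_right_mono)
  have resolvent_power: "norm ((Res s ^^ p) (P w)) \<le> C3 * t ^ p / R * norm w" if s: "\<bar>s\<bar> \<le> R" for s w
  proof (cases "\<bar>s\<bar> \<ge> s0")
    case True
    have "\<bar>s\<bar> * norm (Res s (P w)) = norm (Res s w + P w)"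
      using Res_P[of s w, THEN arg_cong[of _ _ norm]] by (simp add: norm_scaleC norm_mult)
    also have "\<dots> \<le> M \<bar>s\<bar> * norm w + M \<bar>s\<bar> * norm w"
      using P_le[of w] mult_right_mono[OF Mmono[of 0 "\<bar>s\<bar>"], of "norm w"]
      by (intro norm_triangle_mono Res_le) auto
    finally have 1: "norm (Res s (P w)) \<le> 2 * M \<bar>s\<bar> / \<bar>s\<bar> * norm w"
      using True s0 by (simp add: field_simps)
    have "norm ((Res s ^^ p) (P w)) \<le> M \<bar>s\<bar> ^ q * norm (Res s (P w))"
      unfolding q funpow_Suc_right comp_def by (rule norm_funpow_le[OF Res_le M0]) simp
    also have "\<dots> \<le> M \<bar>s\<bar> ^ q * (2 * M \<bar>s\<bar> / \<bar>s\<bar> * norm w)"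
      using 1 M0 by (intro mult_left_mono) auto
    also have "\<dots> = 2 * (M \<bar>s\<bar> ^ p / \<bar>s\<bar>) * norm w" by (simp add: q)
    also have "M \<bar>s\<bar> ^ p / \<bar>s\<bar> \<le> (t / c) ^ p / R"
      using positive_increase_power[OF pos c s0 p\<alpha> inc True s R(2)] True s0
      by (intro quotient_le) auto
    also have "2 * ((t / c) ^ p / R) * norm w = 2 / c ^ p * (t ^ p / R * norm w)"
      by (simp add: power_divide)
    also have "\<dots> \<le> C3 * (t ^ p / R * norm w)"
      using t1 R0 by (intro mult_right_mono C3) auto
    finally show ?thesis by (simp add: mult_right_mono)
  next
    case False
    have "norm ((Res s ^^ p) (P w)) \<le> M s0 ^ p * norm (P w)"
    proof (rule norm_funpow_le)
      show "norm (Res s x) \<le> M s0 * norm x" for x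
        using Res_le[of s x] mult_right_mono[OF Mmono[of "\<bar>s\<bar>" s0], of "norm x"] False by simp
    qed (use M0 s0 in simp)
    also have "\<dots> \<le> M s0 ^ p * (M 0 * norm w)"
      using P_le M0 s0 by (intro mult_left_mono) auto
    \<comment> \<open>Below \<open>s0\<close> the growth condition says nothing, so monotonicity
      moves the estimate to \<open>s0\<close>, where the condition applies.\<close>
    also have "M s0 ^ p \<le> s0 * (t / c) ^ p / R"
      unfolding pos_le_divide_eq[OF R0]
      by (rule positive_increase_power[OF pos c s0 p\<alpha> inc order_refl R])
    also have "s0 * (t / c) ^ p / R * (M 0 * norm w) = M 0 * s0 / c ^ p * (t ^ p / R * norm w)"
      by (simp add: power_divide)
    also have "\<dots> \<le> C3 * (t ^ p / R * norm w)"
      using t1 R0 by (intro mult_right_mono C3) auto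
    finally show ?thesis using M0[of 0] by (simp add: mult_right_mono)
  qed
  \<comment> \<open>\<open>d\<close> dominates the norms of both operators compared in
    \<open>low_frequency_bound\<close>, and \<open>E * h\<close> the resulting error for all
    \<open>\<bar>s\<bar> \<le> R\<close>. As \<open>E\<close> does not involve \<open>m\<close>,
    choosing \<open>m\<close> afterwards makes this error at most \<open>t ^ p / R\<close>.\<close>
  define d where "d = max 1 (max (2 * K * t) ((1 + 2 * K) * M R))"
  define E where "E = p * d ^ p * (2 * K\<^sup>2 * t * (1 + (2 / t + R) * M 0 + M R * M 0 / t\<^sup>2))"
  define m where "m = nat \<lceil>E * t * R / t ^ p\<rceil> + 1"
  define h where "h = t / (2 * m)"
  interpret discretised_semigroup T D A K t h m
    by standard (use t1 in \<open>auto simp: h_def m_def\<close>)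
  have Eh: "E * h \<le> t ^ p / R"
  proof -
    have "E * t * R / t ^ p \<le> 2 * m"
      using real_nat_ceiling_ge[of "E * t * R / t ^ p"] by (simp add: m_def)
    thus ?thesis using t1 R0 m by (simp add: h_def field_simps)
  qed
  define B where "B = ((1 + 2 * K) ^ p * C3 + 1 + (2 * K) ^ q * (pi * (M 0 + 2 * K\<^sup>2))) * t ^ p / R"
  have parts: "(1 + 2 * K) ^ p * C3 \<ge> 0" "(2 * K) ^ q * (pi * (M 0 + 2 * K\<^sup>2)) \<ge> 0"
    using K1 C3 M0[of 0] by simp_all
  have tR: "t ^ p / R \<ge> 0" using t1 R0 by simp
  have "norm (T t (P y)) \<le> 2 * exp 1 * K\<^sup>2 * (2 * real p / t) ^ p * B * norm y"
  proof (rule norm_T_le_multiplier_bound[OF p1])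
    show "B \<ge> 0" using parts t1 R0 by (simp add: B_def)
    fix s w assume sh: "\<bar>s\<bar> * h \<le> pi"
    show "norm ((Q s ^^ p) (P w)) \<le> B * norm w"
    proof (cases "\<bar>s\<bar> \<le> R")
      case True
      have "norm ((Q s ^^ p) (P w)) \<le> (1 + 2 * K) ^ p * norm ((Res s ^^ p) (P w))
          + p * d ^ p * (2 * K\<^sup>2 * t * h * (1 + (2 / t + \<bar>s\<bar>) * M 0 + M R * M 0 / t\<^sup>2) * norm w)"
      proof (rule low_frequency_bound[OF P_le])
        show "norm (Res s x) \<le> M R * norm x" for x
          using Res_le[of s x] mult_right_mono[OF Mmono[of "\<bar>s\<bar>" R], of "norm x"] True by simp
      qed (use M0 R0 in \<open>auto simp: d_def\<close>)
      also have "\<dots> \<le> (1 + 2 * K) ^ p * (C3 * t ^ p / R * norm w) + E * h * norm w"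
      proof (intro add_mono mult_left_mono resolvent_power True)
        have "p * d ^ p * (2 * K\<^sup>2 * t * h * (1 + (2 / t + \<bar>s\<bar>) * M 0 + M R * M 0 / t\<^sup>2) * norm w)
            \<le> p * d ^ p * (2 * K\<^sup>2 * t * h * (1 + (2 / t + R) * M 0 + M R * M 0 / t\<^sup>2) * norm w)"
          using True M0[of 0] t0 h0 by (intro mult_left_mono mult_right_mono add_mono) (auto simp: d_def)
        thus "p * d ^ p * (2 * K\<^sup>2 * t * h * (1 + (2 / t + \<bar>s\<bar>) * M 0 + M R * M 0 / t\<^sup>2) * norm w)
            \<le> E * h * norm w" by (simp add: E_def mult_ac)
      qed (use K1 in simp)
      also have "\<dots> \<le> (1 + 2 * K) ^ p * (C3 * t ^ p / R * norm w) + t ^ p / R * norm w"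
        by (intro add_left_mono mult_right_mono Eh) simp
      also have "\<dots> = ((1 + 2 * K) ^ p * C3 + 1) * (t ^ p / R * norm w)"
        by (simp add: algebra_simps add_divide_distrib)
      also have "\<dots> \<le> ((1 + 2 * K) ^ p * C3 + 1 + (2 * K) ^ q * (pi * (M 0 + 2 * K\<^sup>2))) * (t ^ p / R * norm w)"
        using parts tR by (intro mult_right_mono mult_nonneg_nonneg) auto
      finally show ?thesis by (simp add: B_def)
    next
      case False
      \<comment> \<open>Of the \<open>p\<close> factors, \<open>q = p - 1\<close> cost
        \<open>O(t)\<close> each and the last one, acting on \<open>P w\<close>, gives
        \<open>O(t / \<bar>s\<bar>)\<close>; \<open>t \<ge> 1\<close> absorbs the constant
        \<open>M 0\<close>.\<close>
      have "norm ((Q s ^^ p) (P w)) \<le> (2 * K * t) ^ q * norm (Q s (P w))"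
        unfolding q funpow_Suc_right comp_def using K1 t1 by (intro norm_funpow_le norm_Q_le) simp
      also have "norm (Q s (P w)) \<le> pi * (M 0 + 2 * K\<^sup>2 * t) / \<bar>s\<bar> * norm w"
        using False R0 sh by (intro high_frequency_bound P_le) auto
      also have "pi * (M 0 + 2 * K\<^sup>2 * t) / \<bar>s\<bar> \<le> pi * (M 0 * t + 2 * K\<^sup>2 * t) / R"
        using False R0 t1 M0[of 0] mult_left_mono[OF t1, of "M 0"] by (intro frac_le mult_left_mono add_mono) auto
      also have "(2 * K * t) ^ q * (pi * (M 0 * t + 2 * K\<^sup>2 * t) / R * norm w)
          = (2 * K) ^ q * (pi * (M 0 + 2 * K\<^sup>2)) * (t ^ p / R * norm w)"
        by (simp add: q power_mult_distrib algebra_simps add_divide_distrib)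
      also have "\<dots> \<le> ((1 + 2 * K) ^ p * C3 + 1 + (2 * K) ^ q * (pi * (M 0 + 2 * K\<^sup>2))) * (t ^ p / R * norm w)"
        using parts tR by (intro mult_right_mono mult_nonneg_nonneg) auto
      finally show ?thesis using K1 t1 by (simp add: B_def mult_left_mono mult_right_mono)
    qed
  qed
  also have "\<dots> = 2 * exp 1 * K\<^sup>2 * (2 * real p) ^ p * ((1 + 2 * K) ^ p * C3 + 1
      + (2 * K) ^ (p - 1) * (pi * (M 0 + 2 * K\<^sup>2))) / R * norm y"
    using t1 by (simp add: B_def q power_divide)
  finally show ?thesis by (simp add: C3_def)
qed

end

theorem theorem3p2:
  fixes T :: "real \<Rightarrow> 'a::complex_hilbert \<Rightarrow> 'a"
    and D :: "'a set" and A :: "'a \<Rightarrow> 'a"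
    and M :: "real \<Rightarrow> real"
  assumes "C0_semigroup T" and "bounded_semigroup T"
    and "is_generator T D A"
    and "spectrum D A \<inter> {z. Re z = 0} = {}"
    and "\<forall>s\<ge>0. 0 < M s"
    and "continuous_on {0..} M" and "mono_on {0..} M"
    and "positive_increase 0 M"
    and "\<forall>s::real. onorm (resolvent D A (\<i> * complex_of_real s)) \<le> M \<bar>s\<bar>"
  shows "(\<lambda>t. onorm (T t \<circ> inv_into D A)) \<in> O[at_top](\<lambda>t. 1 / right_inverse 0 M t)"
proof -
  obtain b where b: "\<And>t. t \<ge> 0 \<Longrightarrow> onorm (T t) \<le> b"
    using assms(2) by (auto simp: bounded_semigroup_def bdd_above_def)
  define K where "K = max 1 b"
  interpret bounded_C0_semigroup T D A K
  proof
    fix t :: real and x assume t: "t \<ge> 0"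
    hence "bounded_linear (T t)" using assms(1) by (auto simp: C0_semigroup_def bounded_clinear_def)
    hence "norm (T t x) \<le> onorm (T t) * norm x" by (rule onorm)
    also have "\<dots> \<le> K * norm x" using b[OF t] by (intro mult_right_mono) (auto simp: K_def)
    finally show "norm (T t x) \<le> K * norm x" .
  qed (use assms in \<open>auto simp: K_def\<close>)
  obtain \<alpha> c s0 where \<alpha>: "\<alpha> > 0" and c: "c > 0" and s0: "s0 > 0"
    and inc: "\<And>l s. l \<ge> 1 \<Longrightarrow> s \<ge> s0 \<Longrightarrow> M (l * s) / M s \<ge> c * l powr \<alpha>"
    using assms(8) unfolding positive_increase_def by blast
  have pos: "\<And>s. s \<ge> 0 \<Longrightarrow> M s > 0" using assms(5) by blast
  have Res_le: "norm (Res s x) \<le> M \<bar>s\<bar> * norm x" for s x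
    using onorm[OF Res_bounded_linear[of s], of x] assms(9)
    by (meson mult_right_mono norm_ge_zero order_trans)
  define p where "p = nat \<lceil>1 / \<alpha>\<rceil> + 1"
  have p: "p \<ge> 1" "p * \<alpha> \<ge> 1"
  proof -
    have "1 / \<alpha> \<le> p" unfolding p_def using real_nat_ceiling_ge[of "1 / \<alpha>"] by linarith
    thus "p * \<alpha> \<ge> 1" using \<alpha> by (simp add: field_simps)
  qed (simp add: p_def)
  define C where "C = 2 * exp 1 * K\<^sup>2 * (2 * real p) ^ p
    * ((1 + 2 * K) ^ p * ((2 + M 0 * s0) / c ^ p) + 1 + (2 * K) ^ (p - 1) * (pi * (M 0 + 2 * K\<^sup>2)))"
  \<comment> \<open>The threshold for \<open>t\<close> puts \<open>s0\<close> into the level set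
    below, so that \<open>R \<ge> s0\<close>.\<close>
  have upper: "onorm (T t \<circ> inv_into D A) \<le> C * (1 / right_inverse 0 M t) \<and> right_inverse 0 M t > 0"
    if t: "t \<ge> max 1 (M s0)" for t
  proof -
    define I where "I = {r. 0 \<le> r \<and> M r \<le> t}"
    define R where "R = right_inverse 0 M t"
    have ne: "s0 \<in> I" using s0 t by (simp add: I_def)
    \<comment> \<open>\<open>positive_increase_power\<close> with \<open>r\<close> in the role of
      \<open>R\<close> bounds every \<open>r \<ge> s0\<close> in the level set; this is the
      divergence of \<open>M\<close> in quantitative form.\<close>
    have bdd: "bdd_above I"
    proof (rule bdd_aboveI)
      fix r assume r: "r \<in> I"
      show "r \<le> max s0 (s0 * (t / c) ^ p / M s0 ^ p)"
      proof (cases "r \<ge> s0")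
        case True
        have "M s0 ^ p * r \<le> s0 * (t / c) ^ p"
          using r by (intro positive_increase_power[OF pos c s0 p(2) inc] True) (auto simp: I_def)
        hence "r \<le> s0 * (t / c) ^ p / M s0 ^ p"
          using pos[of s0] s0 by (simp add: pos_le_divide_eq mult.commute)
        thus ?thesis by simp
      qed simp
    qed
    \<comment> \<open>Continuity of \<open>M\<close> makes the supremum an element of the level set,
      which gives \<open>M R \<le> t\<close>.\<close>
    have "closed I"
    proof -
      have "I = {0..} \<inter> M -` {..t}" by (auto simp: I_def)
      thus ?thesis using continuous_closed_preimage[OF assms(6), of "{..t}"] by simp
    qed
    hence "R \<in> I"
      unfolding R_def right_inverse_def using closed_contains_Sup[OF _ bdd] ne by (auto simp: I_def)
    moreover have "s0 \<le> R"
      unfolding R_def right_inverse_def using cSup_upper[OF ne bdd] by (simp add: I_def)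
    ultimately have R: "s0 \<le> R" "M R \<le> t" by (auto simp: I_def)
    have "norm (T t (inv_into D A y)) \<le> C / R * norm y" for y
      unfolding C_def using norm_T_P_le[OF Res_le pos assms(7) c s0 p(2,1) inc R] t by simp
    moreover have "C / R \<ge> 0"
      using R s0 K1 c pos[of 0] by (auto simp: C_def intro!: divide_nonneg_nonneg mult_nonneg_nonneg add_nonneg_nonneg)
    ultimately have "onorm (T t \<circ> inv_into D A) \<le> C / R" by (intro onorm_bound) auto
    thus ?thesis using R s0 by (simp add: R_def)
  qed
  have nonneg: "onorm (T t \<circ> inv_into D A) \<ge> 0" if "t \<ge> 0" for t
    using bounded_linear_compose[OF T_bounded_linear[OF that] P_bounded_linear]
    by (intro onorm_pos_le) (simp add: comp_def)
  have "norm (onorm (T t \<circ> inv_into D A)) \<le> C * norm (1 / right_inverse 0 M t)"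
    if "t \<ge> max 1 (M s0)" for t
    using upper[OF that] nonneg[of t] that by simp
  hence "\<forall>\<^sub>F t in at_top. norm (onorm (T t \<circ> inv_into D A)) \<le> C * norm (1 / right_inverse 0 M t)"
    by (rule eventually_at_top_linorderI)
  thus ?thesis by (rule bigoI)
qed

end
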